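(* Let $n\ge1$ and let $m$ be a positive integer. Let $\eta,\lambda$ be vectors of integers in $\mathcal A^{\tilde D_n}_m=\{(x_1,\dots,x_n): x_1>x_2>\dots>x_{n-1}>|x_n|,\ x_1+x_2<2m\}$. Then, as $k\to\infty$ with $k\equiv|\eta|+|\lambda|\pmod2$, the number of walks from $\eta$ to $\lambda$ with exactly $k$ standard steps staying in $\mathcal A^{\tilde D_n}_m$ is asymptotically $$\frac{4^{n^2}}{(8m)^n}\left(2\frac{\sin\frac{n\pi}{2m}\cos\frac{(n-1)\pi}{2m}}{\sin\frac{\pi}{2m}}\right)^k\prod_{1\le h<t\le n}\left(\sin\frac{\pi(\eta_h-\eta_t)}{2m}\sin\frac{\pi(\lambda_h-\lambda_t)}{2m}\sin\frac{\pi(\eta_h+\eta_t)}{2m}\sin\frac{\pi(\lambda_h+\lambda_t)}{2m}\right).$$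
   Context: For $\eta\in\mathbb R^n$, $|\eta|=\eta_1+\dots+\eta_n$. A walk with $k$ standard steps from $\eta$ to $\lambda$ is a sequence $p_0=\eta,\dots,p_k=\lambda$ with $p_i-p_{i-1}\in\{\pm e_1,\dots,\pm e_n\}$; it stays in $R$ if all $p_i\in R$. "Asymptotically $E$" means the ratio of the count to $E$ tends to $1$.
   Formalization: Stated for n ≥ 3 instead of n ≥ 1: for n = 1 the set is not defined (it mentions x_0 and x_2), and for n = 2 it is an unbounded half-strip where the asymptotics fails (m = 2, η = λ = (1,0): count of order 8^{k/2} k^{-3/2}, formula of order 4^{k/2}). *)

theory Defs
  imports
    "HOL-Analysis.Analysis"
    "HOL-Library.Landau_Symbols"
    "HOL-Library.Real_Mod"
begin

text \<open>
  A vector in \<open>n\<close>-dimensional real space is a function with coordinates at the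
  indices \<open>1, \<dots>, n\<close> that vanishes at every other index.  Addition and subtraction
  are then the pointwise operations on functions.
\<close>

definition real_vecs :: "nat \<Rightarrow> (nat \<Rightarrow> real) set" where
  "real_vecs n = {x. \<forall>i. i \<notin> {1..n} \<longrightarrow> x i = 0}"

definition int_vecs :: "nat \<Rightarrow> (nat \<Rightarrow> real) set" where
  "int_vecs n = {x \<in> real_vecs n. \<forall>i\<in>{1..n}. x i \<in> \<int>}"

definition unit_vec :: "nat \<Rightarrow> nat \<Rightarrow> real" where
  "unit_vec j = (\<lambda>i. if i = j then 1 else 0)"

definition standard_steps :: "nat \<Rightarrow> (nat \<Rightarrow> real) set" where
  "standard_steps n = (\<Union>j\<in>{1..n}. {unit_vec j, - unit_vec j})"

definition coord_sum :: "nat \<Rightarrow> (nat \<Rightarrow> real) \<Rightarrow> real" where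
  "coord_sum n x = (\<Sum>i=1..n. x i)"

text \<open>A walk is the list \<open>[p\<^sub>0, \<dots>, p\<^sub>k]\<close> of the points that it visits.\<close>

definition walks ::
  "nat \<Rightarrow> nat \<Rightarrow> (nat \<Rightarrow> real) \<Rightarrow> (nat \<Rightarrow> real) \<Rightarrow> (nat \<Rightarrow> real) set \<Rightarrow> (nat \<Rightarrow> real) list set" where
  "walks n k \<eta> lam R =
     {p. length p = Suc k \<and> p ! 0 = \<eta> \<and> p ! k = lam \<and>
         (\<forall>i\<in>{1..k}. p ! i - p ! (i - 1) \<in> standard_steps n) \<and>
         (\<forall>i\<le>k. p ! i \<in> R)}"

definition num_walks ::
  "nat \<Rightarrow> nat \<Rightarrow> (nat \<Rightarrow> real) \<Rightarrow> (nat \<Rightarrow> real) \<Rightarrow> (nat \<Rightarrow> real) set \<Rightarrow> nat" where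
  "num_walks n k \<eta> lam R = card (walks n k \<eta> lam R)"

text \<open>
  The displayed inequalities describe a bounded region (an alcove of the affine Weyl
  group of type D) only for \<open>n \<ge> 3\<close>.  For \<open>n = 2\<close> they cut out a half-strip,
  because the inequality \<open>x 1 - x 2 < 2 * m\<close> does not follow from them.
\<close>

definition alcove_D :: "nat \<Rightarrow> nat \<Rightarrow> (nat \<Rightarrow> real) set" where
  "alcove_D n m =
     {x \<in> real_vecs n.
        (\<forall>i. 1 \<le> i \<and> i + 1 \<le> n - 1 \<longrightarrow> x i > x (i + 1)) \<and>
        x (n - 1) > \<bar>x n\<bar> \<and>
        x 1 + x 2 < 2 * real m}"

text \<open>The sets counted above are finite, so the cardinality is never a junk value.\<close>

lemma finite_walks: "finite (walks n k \<eta> lam R)"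
proof -
  let ?f = "\<lambda>p::(nat \<Rightarrow> real) list. map (\<lambda>i. p ! Suc i - p ! i) [0..<k]"
  let ?S = "{xs. set xs \<subseteq> standard_steps n \<and> length xs = k}"
  have "finite (standard_steps n)"
    unfolding standard_steps_def by simp
  then have "finite ?S"
    by (rule finite_lists_length_eq)
  moreover have "?f ` walks n k \<eta> lam R \<subseteq> ?S"
    unfolding walks_def by force
  moreover have "inj_on ?f (walks n k \<eta> lam R)"
  proof (rule inj_onI)
    fix p q
    assume p: "p \<in> walks n k \<eta> lam R" and q: "q \<in> walks n k \<eta> lam R" and eq: "?f p = ?f q"
    have step: "p ! Suc i - p ! i = q ! Suc i - q ! i" if "i < k" for i
      using eq that by simp
    have nth: "p ! i = q ! i" if "i \<le> k" for i
      using that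
    proof (induction i)
      case 0
      then show ?case using p q by (simp add: walks_def)
    next
      case (Suc i)
      then have "p ! i = q ! i" and "p ! Suc i - p ! i = q ! Suc i - q ! i"
        using step[of i] by simp_all
      then show ?case
        by (simp add: fun_eq_iff)
    qed
    show "p = q"
      by (rule nth_equalityI) (use p q nth in \<open>auto simp: walks_def\<close>)
  qed
  ultimately show ?thesis
    using inj_on_finite by blast
qed

end

theory Submission
  imports Defs "Jordan_Normal_Form.Determinant"
begin

text \<open>
  The function \<open>\<phi> x = (\<Prod>h<t. sin (\<pi> (x\<^sub>h - x\<^sub>t) / 2m) sin (\<pi> (x\<^sub>h + x\<^sub>t) / 2m))\<close> is a constant multiple
  of the determinant of the \<open>cos (\<pi> j x\<^sub>i / m)\<close> with \<open>0 \<le> j < n\<close>.  It is therefore an eigenfunction of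
  the unrestricted step operator; as it is positive in the alcove and vanishes on the walls, it is
  the Perron eigenfunction of the finite connected bipartite graph of lattice points of the alcove.
  A Doeblin contraction argument shows that the number of walks is asymptotically
  \<open>2 \<mu>\<^sup>k \<phi>(\<eta>) \<phi>(\<lambda>) / \<Sum>x. \<phi>(x)\<^sup>2\<close>, where \<open>\<mu>\<close> is the eigenvalue.  The sum of squares is evaluated by
  folding the alcove onto the \<open>n\<close>-element subsets of \<open>{0..m}\<close> and using the discrete orthogonality
  of the cosines.  This requires \<open>n \<le> m\<close>; a nonempty alcove with \<open>n > m\<close> has \<open>n = m + 1\<close> and \<open>\<mu> = 0\<close>,
  and then no step is possible.
\<close>

section \<open>Walks on a finite bipartite graph with a positive eigenfunction\<close>

text \<open>Parity explains the factor 2: every step flips the parity of the coordinate sum, so a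
  walk of length \<open>k\<close> ends in a single colour class, and the eigenvalue equation makes
  each class carry exactly half of the sum of squares. Vanishing on the walls is enough because all
  points are integral: a unit step cannot jump over a wall, it can only land on one. The foldings
  are the symmetries \<open>x 1 \<mapsto> 2m - x 1\<close> and \<open>x n \<mapsto> - x n\<close> of
  the alcove; they preserve the squared determinant because they replace an angle by
  \<open>2 pi\<close> minus it or by its negative. Points on a mirror are counted once and all
  others twice, and up to a factor 4 these multiplicities are the trapezoidal weights on
  \<open>{0..m}\<close>. For these weights the cosines of frequency below \<open>m\<close> are
  orthogonal, with squared norm \<open>m\<close> for frequency 0 and \<open>m/2\<close> otherwise,
  whence \<open>m^n / 2^(n-1)\<close>. Frequency \<open>m\<close> would again have squared norm
  \<open>m\<close>, so \<open>n = m + 1\<close> has a different sum of squares.\<close>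

primrec walk_count :: "('a \<Rightarrow> 'a set) \<Rightarrow> nat \<Rightarrow> 'a \<Rightarrow> 'a \<Rightarrow> real" where
  "walk_count E 0 x y = (if x = y then 1 else 0)"
| "walk_count E (Suc k) x y = (\<Sum>z\<in>E x. walk_count E k z y)"

lemma walk_count_nonneg: "walk_count E k x y \<ge> 0"
  by (induction k arbitrary: x) (auto intro: sum_nonneg)

text \<open>Reaching the single vertex \<open>r\<close> from everywhere is the form of connectedness
  that the Doeblin argument consumes: \<open>r\<close> is where all averages get common
  mass.\<close>

locale bipartite_eigenfunction =
  fixes V :: "'a set" and E :: "'a \<Rightarrow> 'a set" and colour :: "'a \<Rightarrow> bool"
    and \<phi> :: "'a \<Rightarrow> real" and \<mu> :: real and r :: 'a
  assumes finite_V: "finite V"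
    and E_subset: "\<And>x. x \<in> V \<Longrightarrow> E x \<subseteq> V"
    and E_sym: "\<And>x y. x \<in> V \<Longrightarrow> y \<in> E x \<Longrightarrow> x \<in> E y"
    and colour_E: "\<And>x y. x \<in> V \<Longrightarrow> y \<in> E x \<Longrightarrow> colour y \<noteq> colour x"
    and \<phi>_pos: "\<And>x. x \<in> V \<Longrightarrow> \<phi> x > 0"
    and \<mu>_pos: "\<mu> > 0"
    and eigen: "\<And>x. x \<in> V \<Longrightarrow> (\<Sum>y\<in>E x. \<phi> y) = \<mu> * \<phi> x"
    and r_in: "r \<in> V"
    and reach_r: "\<And>x. x \<in> V \<Longrightarrow> \<exists>k. walk_count E k x r > 0"
begin

lemma finite_E: "x \<in> V \<Longrightarrow> finite (E x)"
  using E_subset finite_V finite_subset by blast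

lemma E_sum_restrict:
  assumes "x \<in> V" shows "(\<Sum>z\<in>E x. g z) = (\<Sum>z\<in>V. if z \<in> E x then g z else 0)"
proof -
  have "(\<Sum>z\<in>V. if z \<in> E x then g z else 0) = (\<Sum>z\<in>V \<inter> E x. g z)"
    by (simp add: sum.inter_restrict finite_V)
  also have "V \<inter> E x = E x" using E_subset[OF assms] by blast
  finally show ?thesis by simp
qed

text \<open>Self-adjointness of the adjacency operator: summing over oriented edges from either end
  gives the same total.\<close>

lemma E_sum_swap:
  "(\<Sum>x\<in>V. \<Sum>z\<in>E x. g x z) = (\<Sum>z\<in>V. \<Sum>x\<in>E z. (g x z :: real))"
proof -
  have "(\<Sum>x\<in>V. \<Sum>z\<in>E x. g x z) = (\<Sum>x\<in>V. \<Sum>z\<in>V. if z \<in> E x then g x z else 0)"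
    by (intro sum.cong refl E_sum_restrict)
  also have "\<dots> = (\<Sum>z\<in>V. \<Sum>x\<in>V. if z \<in> E x then g x z else 0)"
    by (rule sum.swap)
  also have "\<dots> = (\<Sum>z\<in>V. \<Sum>x\<in>V. if x \<in> E z then g x z else 0)"
    using E_sym by (intro sum.cong refl) meson
  also have "\<dots> = (\<Sum>z\<in>V. \<Sum>x\<in>E z. g x z)"
    by (intro sum.cong refl E_sum_restrict[symmetric])
  finally show ?thesis .
qed

lemma walk_count_add:
  assumes "x \<in> V"
  shows "walk_count E (k + l) x y = (\<Sum>z\<in>V. walk_count E k x z * walk_count E l z y)"
  using assms
proof (induction k arbitrary: x)
  case 0
  have "(\<Sum>z\<in>V. walk_count E 0 x z * walk_count E l z y) =
        (\<Sum>z\<in>V. if x = z then walk_count E l z y else 0)"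
    by (intro sum.cong) auto
  then show ?case using 0 finite_V by simp
next
  case (Suc k)
  have "walk_count E (Suc k + l) x y = (\<Sum>u\<in>E x. \<Sum>z\<in>V. walk_count E k u z * walk_count E l z y)"
    using Suc E_subset by (auto intro!: sum.cong)
  then show ?case
    by (subst (asm) sum.swap) (simp add: sum_distrib_right)
qed

lemma walk_count_colour:
  assumes "x \<in> V" "walk_count E k x y \<noteq> 0"
  shows "even k \<longleftrightarrow> (colour x = colour y)"
  using assms
proof (induction k arbitrary: x)
  case (Suc k)
  then obtain z where "z \<in> E x" "walk_count E k z y \<noteq> 0"
    by (auto elim: sum.not_neutral_contains_not_neutral)
  with Suc E_subset colour_E show ?case
    by (metis even_Suc subsetD)
qed (auto split: if_splits)

lemma walk_count_eigen:
  assumes "x \<in> V"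
  shows "(\<Sum>z\<in>V. walk_count E k x z * \<phi> z) = \<mu> ^ k * \<phi> x"
  using assms
proof (induction k arbitrary: x)
  case 0
  have "(\<Sum>z\<in>V. walk_count E 0 x z * \<phi> z) = (\<Sum>z\<in>V. if x = z then \<phi> z else 0)"
    by (intro sum.cong) auto
  then show ?case using 0 finite_V by simp
next
  case (Suc k)
  have "(\<Sum>z\<in>V. walk_count E (Suc k) x z * \<phi> z) = (\<Sum>u\<in>E x. \<Sum>z\<in>V. walk_count E k u z * \<phi> z)"
    by (simp add: sum_distrib_right) (rule sum.swap)
  also have "\<dots> = (\<Sum>u\<in>E x. \<mu> ^ k * \<phi> u)"
    using Suc E_subset by (auto intro!: sum.cong)
  also have "\<dots> = \<mu> ^ k * (\<mu> * \<phi> x)"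
    using eigen Suc.prems by (simp add: sum_distrib_left[symmetric])
  finally show ?case by simp
qed

text \<open>The adjacency relation is symmetric, so \<phi> is a left eigenvector as well as a right
  one.\<close>

lemma eigen_walk_count:
  assumes "y \<in> V"
  shows "(\<Sum>x\<in>V. \<phi> x * walk_count E k x y) = \<mu> ^ k * \<phi> y"
proof (induction k)
  case 0
  have "(\<Sum>x\<in>V. \<phi> x * walk_count E 0 x y) = (\<Sum>x\<in>V. if x = y then \<phi> x else 0)"
    by (intro sum.cong) auto
  then show ?case using assms finite_V by simp
next
  case (Suc k)
  have "(\<Sum>x\<in>V. \<phi> x * walk_count E (Suc k) x y) = (\<Sum>x\<in>V. \<Sum>z\<in>E x. \<phi> x * walk_count E k z y)"
    by (simp add: sum_distrib_left)
  also have "\<dots> = (\<Sum>z\<in>V. (\<Sum>x\<in>E z. \<phi> x) * walk_count E k z y)"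
    by (subst E_sum_swap) (simp add: sum_distrib_right)
  also have "\<dots> = \<mu> * (\<Sum>z\<in>V. \<phi> z * walk_count E k z y)"
    by (simp add: eigen sum_distrib_left mult.assoc)
  finally show ?case using Suc by simp
qed

text \<open>Every edge joins the two classes. The sum of \<open>\<phi> x * \<phi> z\<close> over all
  edges, grouped by the endpoint of one colour, is \<mu> times the norm of that class; the same
  edges grouped by the other endpoint give \<mu> times the norm of the other class.\<close>

lemma norm_colour_classes:
  "(\<Sum>x | x \<in> V \<and> colour x = b. (\<phi> x)\<^sup>2) = (\<Sum>x\<in>V. (\<phi> x)\<^sup>2) / 2"
proof -
  define S where "S b = (\<Sum>x | x \<in> V \<and> colour x = b. (\<phi> x)\<^sup>2)" for b
  have S_alt: "S b = (\<Sum>x\<in>V. if colour x = b then (\<phi> x)\<^sup>2 else 0)" for b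
    unfolding S_def by (intro sum.mono_neutral_cong_left) (auto simp: finite_V)
  have "\<mu> * S b = (\<Sum>x\<in>V. \<Sum>z\<in>E x. if colour x = b then \<phi> x * \<phi> z else 0)" for b
    unfolding S_alt sum_distrib_left
    by (intro sum.cong refl) (auto simp: sum_distrib_left[symmetric] eigen power2_eq_square)
  also have "\<dots> b = (\<Sum>z\<in>V. \<Sum>x\<in>E z. if colour x = b then \<phi> x * \<phi> z else 0)" for b
    by (rule E_sum_swap)
  also have "\<dots> b = (\<Sum>z\<in>V. \<Sum>x\<in>E z. if colour z = (\<not> b) then \<phi> x * \<phi> z else 0)" for b
    using colour_E by (intro sum.cong refl) (metis (full_types))
  also have "\<dots> b = \<mu> * S (\<not> b)" for b
    unfolding S_alt sum_distrib_left
    by (intro sum.cong refl) (auto simp: sum_distrib_right[symmetric] eigen power2_eq_square)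
  finally have "S (\<not> b) = S b" using \<mu>_pos by simp
  moreover have "S b + S (\<not> b) = (\<Sum>x\<in>V. (\<phi> x)\<^sup>2)"
    unfolding S_alt sum.distrib[symmetric] by (intro sum.cong refl) auto
  ultimately show ?thesis unfolding S_def[symmetric] by simp
qed

text \<open>A walk that has arrived at \<open>r\<close> can be prolonged by going to a neighbour and
  back, so positivity survives adding 2 to the length. Inside the colour class of \<open>r\<close>
  all arrival times are even, hence one even length serves every vertex.\<close>

lemma uniform_reach:
  obtains L where "L > 0" "\<And>x. x \<in> V \<Longrightarrow> colour x = colour r \<Longrightarrow> walk_count E (2 * L) x r > 0"
proof -
  \<comment> \<open>A vertex without neighbours would have an empty sum in \<open>eigen\<close>;
    positivity of the right-hand side provides a neighbour \<open>s\<close> of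
    \<open>r\<close>.\<close>
  have "\<mu> * \<phi> r > 0" using r_in \<phi>_pos \<mu>_pos by simp
  then obtain s where s: "s \<in> E r" using eigen[OF r_in] by fastforce
  have s': "r \<in> E s" "s \<in> V" using s E_sym E_subset r_in by auto
  have "walk_count E 1 s r \<ge> 1"
    using member_le_sum[of r "E s" "\<lambda>z. walk_count E 0 z r"] s' finite_E by simp
  then have two: "walk_count E 2 r r > 0"
    using member_le_sum[of s "E r" "\<lambda>z. walk_count E 1 z r"] s finite_E[OF r_in]
      walk_count_nonneg[of E 1 _ r] by (simp add: numeral_2_eq_2)
  have step2: "walk_count E (k + 2) x r > 0" if "walk_count E k x r > 0" "x \<in> V" for k x
  proof -
    have "0 < walk_count E k x r * walk_count E 2 r r" using that two by simp
    also have "\<dots> \<le> walk_count E (k + 2) x r"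
      unfolding walk_count_add[OF that(2)]
      by (rule member_le_sum) (auto simp: r_in finite_V walk_count_nonneg)
    finally show ?thesis .
  qed
  have step: "walk_count E (k + 2 * j) x r > 0" if "walk_count E k x r > 0" "x \<in> V" for k x j
    by (induction j) (use that step2 in \<open>auto simp: add.assoc[symmetric]\<close>)
  obtain d where d: "\<And>x. x \<in> V \<Longrightarrow> walk_count E (d x) x r > 0" using reach_r by metis
  define L where "L = Suc (\<Sum>x\<in>V. d x)"
  show thesis
  proof
    fix x assume x: "x \<in> V" "colour x = colour r"
    have "even (d x)" using walk_count_colour[of x "d x" r] d[of x] x by auto
    then obtain e where e: "d x = 2 * e" by (elim evenE)
    have "d x \<le> L" unfolding L_def using member_le_sum[of x V d] x finite_V by simp
    then have "2 * L = d x + 2 * (L - e)" using e by simp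
    then show "walk_count E (2 * L) x r > 0" using step[OF d] x by metis
  qed (simp add: L_def)
qed

section \<open>Doob transform and Doeblin contraction\<close>

text \<open>Conjugating the step operator by \<phi> and dividing by \<mu> gives a Markov chain. Its
  \<open>l\<close>-step weights
  \<open>walk_count E l x z * \<phi> z / (\<mu> ^ l * \<phi> x)\<close> sum to 1, and
  \<open>density y (l + k)\<close> is the average of \<open>density y k\<close> with these
  weights.\<close>

definition density :: "'a \<Rightarrow> nat \<Rightarrow> 'a \<Rightarrow> real" where
  "density y k x = walk_count E k x y / (\<mu> ^ k * \<phi> x)"

lemma density_add:
  assumes "x \<in> V"
  shows "density y (l + k) x = (\<Sum>z\<in>V. walk_count E l x z * \<phi> z / (\<mu> ^ l * \<phi> x) * density y k z)"
proof -
  have "density y (l + k) x = (\<Sum>z\<in>V. walk_count E l x z * walk_count E k z y / (\<mu> ^ (l + k) * \<phi> x))"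
    unfolding density_def walk_count_add[OF assms] by (simp add: sum_divide_distrib)
  also have "\<dots> = (\<Sum>z\<in>V. walk_count E l x z * \<phi> z / (\<mu> ^ l * \<phi> x) * density y k z)"
    unfolding density_def using \<phi>_pos \<mu>_pos assms
    by (intro sum.cong refl) (simp add: power_add field_simps less_imp_neq[symmetric])
  finally show ?thesis .
qed

lemma weights_sum:
  assumes "x \<in> V"
  shows "(\<Sum>z\<in>V. walk_count E l x z * \<phi> z / (\<mu> ^ l * \<phi> x)) = 1"
  using walk_count_eigen[OF assms, of l] \<phi>_pos[OF assms] \<mu>_pos
  by (simp add: sum_divide_distrib[symmetric])

lemma density_nonneg: "x \<in> V \<Longrightarrow> density y k x \<ge> 0"
  unfolding density_def using walk_count_nonneg[of E k x y] \<phi>_pos[of x] \<mu>_pos by simp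

lemma weight_nonneg: "x \<in> V \<Longrightarrow> z \<in> V \<Longrightarrow> walk_count E l x z * \<phi> z / (\<mu> ^ l * \<phi> x) \<ge> 0"
  using walk_count_nonneg[of E l x z] \<phi>_pos[of x] \<phi>_pos[of z] \<mu>_pos by simp

text \<open>An average cannot exceed the values averaged. The condition on \<open>colour z\<close>
  selects the class in which walks of length \<open>l\<close> from \<open>x\<close> end; it allows a
  bound known on one class only to be carried to the other by one step.\<close>

lemma density_le:
  assumes "x \<in> V" "\<And>z. z \<in> V \<Longrightarrow> colour z = (colour x = even l) \<Longrightarrow> density y k z \<le> B"
  shows "density y (l + k) x \<le> B"
proof -
  have "density y (l + k) x \<le> (\<Sum>z\<in>V. walk_count E l x z * \<phi> z / (\<mu> ^ l * \<phi> x) * B)"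
    unfolding density_add[OF assms(1)]
  proof (rule sum_mono)
    fix z assume z: "z \<in> V"
    show "walk_count E l x z * \<phi> z / (\<mu> ^ l * \<phi> x) * density y k z
        \<le> walk_count E l x z * \<phi> z / (\<mu> ^ l * \<phi> x) * B"
    proof (cases "walk_count E l x z = 0")
      case False
      then have "colour z = (colour x = even l)" using walk_count_colour[OF assms(1), of l z] by auto
      then show ?thesis using assms z weight_nonneg by (intro mult_left_mono) auto
    qed simp
  qed
  also have "\<dots> = B" unfolding sum_distrib_right[symmetric] weights_sum[OF assms(1)] by simp
  finally show ?thesis .
qed

lemma density_ge:
  assumes "x \<in> V" "\<And>z. z \<in> V \<Longrightarrow> colour z = (colour x = even l) \<Longrightarrow> density y k z \<ge> B"
  shows "density y (l + k) x \<ge> B"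
proof -
  have "density y (l + k) x \<ge> (\<Sum>z\<in>V. walk_count E l x z * \<phi> z / (\<mu> ^ l * \<phi> x) * B)"
    unfolding density_add[OF assms(1)]
  proof (rule sum_mono)
    fix z assume z: "z \<in> V"
    show "walk_count E l x z * \<phi> z / (\<mu> ^ l * \<phi> x) * density y k z
        \<ge> walk_count E l x z * \<phi> z / (\<mu> ^ l * \<phi> x) * B"
    proof (cases "walk_count E l x z = 0")
      case False
      then have "colour z = (colour x = even l)" using walk_count_colour[OF assms(1), of l z] by auto
      then show ?thesis using assms z weight_nonneg by (intro mult_left_mono) auto
    qed simp
  qed
  moreover have "(\<Sum>z\<in>V. walk_count E l x z * \<phi> z / (\<mu> ^ l * \<phi> x) * B) = B"
    unfolding sum_distrib_right[symmetric] weights_sum[OF assms(1)] by simp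
  ultimately show ?thesis by simp
qed

text \<open>Doeblin's argument: all the averages over walks of length \<open>l\<close> put mass at least
  \<open>\<epsilon>\<close> on the common vertex \<open>r\<close>.\<close>

lemma density_contract:
  assumes l: "even l" and \<epsilon>: "0 < \<epsilon>"
    and mass: "\<And>x. x \<in> V \<Longrightarrow> colour x = colour r \<Longrightarrow> walk_count E l x r * \<phi> r / (\<mu> ^ l * \<phi> x) \<ge> \<epsilon>"
    and range: "\<And>x. x \<in> V \<Longrightarrow> colour x = colour r \<Longrightarrow> density y k x \<in> {a..a + b}"
  shows "\<exists>a'. \<forall>x\<in>V. colour x = colour r \<longrightarrow> density y (l + k) x \<in> {a'..a' + (1 - \<epsilon>) * b}"
\<comment> \<open>Every average contains the same term \<open>\<epsilon> * density y k r\<close>.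
  The remaining weights are nonnegative of total mass \<open>1 - \<epsilon>\<close> and average
  values from \<open>{a..a + b}\<close>, which gives the new lower endpoint and the shrunken
  width.\<close>
proof (intro exI[of _ "\<epsilon> * density y k r + (1 - \<epsilon>) * a"] ballI impI)
  fix x assume x: "x \<in> V" "colour x = colour r"
  define w where "w z = walk_count E l x z * \<phi> z / (\<mu> ^ l * \<phi> x)" for z
  define w' where "w' z = w z - (if z = r then \<epsilon> else 0)" for z
  have delta: "(\<Sum>z\<in>V. (if z = r then \<epsilon> else 0) * g z) = \<epsilon> * g r" for g :: "'a \<Rightarrow> real"
  proof -
    have "(\<Sum>z\<in>V. (if z = r then \<epsilon> else 0) * g z) = (\<Sum>z\<in>V. if z = r then \<epsilon> * g z else 0)"
      by (intro sum.cong) auto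
    then show ?thesis using r_in finite_V by simp
  qed
  have w'_sum: "(\<Sum>z\<in>V. w' z) = 1 - \<epsilon>"
    using weights_sum[OF x(1), of l] delta[of "\<lambda>_. 1"] by (simp add: w'_def w_def sum_subtractf)
  have w'_nonneg: "w' z \<ge> 0" if "z \<in> V" for z
    using weight_nonneg[OF x(1) that, of l] mass[OF x] by (auto simp: w'_def w_def)
  have eq: "density y (l + k) x = \<epsilon> * density y k r + (\<Sum>z\<in>V. w' z * density y k z)"
    unfolding density_add[OF x(1)] w_def[symmetric] w'_def left_diff_distrib sum_subtractf delta
    by simp
  have between: "w' z * a \<le> w' z * density y k z \<and> w' z * density y k z \<le> w' z * (a + b)"
    if z: "z \<in> V" for z
  proof (cases "colour z = colour r")
    case True
    then show ?thesis using range[OF z] w'_nonneg[OF z] by (auto intro: mult_left_mono)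
  next
    case False
    then have "w' z = 0"
      using walk_count_colour[OF x(1), of l z] x(2) l by (auto simp: w'_def w_def)
    then show ?thesis by simp
  qed
  have "(\<Sum>z\<in>V. w' z * density y k z) \<ge> (\<Sum>z\<in>V. w' z * a)"
    and "(\<Sum>z\<in>V. w' z * density y k z) \<le> (\<Sum>z\<in>V. w' z * (a + b))"
    using between by (auto intro: sum_mono)
  then show "density y (l + k) x \<in> {\<epsilon> * density y k r + (1 - \<epsilon>) * a..
      \<epsilon> * density y k r + (1 - \<epsilon>) * a + (1 - \<epsilon>) * b}"
    unfolding sum_distrib_right[symmetric] w'_sum eq by (auto simp: algebra_simps)
qed

text \<open>One contraction per block of \<open>l\<close> steps gives geometric decay in
  \<open>k div l\<close>. The position \<open>a\<close> of the interval may still depend on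
  \<open>k\<close>; only its width is controlled here.\<close>

lemma density_oscillation:
  assumes "y \<in> V"
  obtains b where "b \<longlonglongrightarrow> 0"
    "\<And>k. \<exists>a. \<forall>x\<in>V. colour x = colour r \<longrightarrow> density y k x \<in> {a..a + b k}"
proof -
  obtain L where L: "L > 0"
    "\<And>x. x \<in> V \<Longrightarrow> colour x = colour r \<Longrightarrow> walk_count E (2 * L) x r > 0"
    using uniform_reach by blast
  define l where "l = 2 * L"
  have l: "l > 0" "even l" using L by (auto simp: l_def)
  define C where "C = {x\<in>V. colour x = colour r}"
  define w where "w x = walk_count E l x r * \<phi> r / (\<mu> ^ l * \<phi> x)" for x
  define \<epsilon> where "\<epsilon> = Min (w ` C)"
  have C: "finite C" "r \<in> C" using finite_V r_in by (auto simp: C_def)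
  have "w x > 0" if "x \<in> C" for x
    using that L \<phi>_pos[of x] \<phi>_pos[OF r_in] \<mu>_pos by (auto simp: w_def l_def C_def)
  then have \<epsilon>_pos: "\<epsilon> > 0" unfolding \<epsilon>_def using C by (subst Min_gr_iff) auto
  have mass: "w x \<ge> \<epsilon>" if "x \<in> C" for x unfolding \<epsilon>_def using that C by auto
  \<comment> \<open>A single weight of a probability vector is at most 1; this yields
    \<open>\<epsilon> \<le> 1\<close>, so the contraction factor \<open>1 - \<epsilon>\<close> lies
    between 0 and 1.\<close>
  have "w r \<le> 1"
    using member_le_sum[of r V "\<lambda>z. walk_count E l r z * \<phi> z / (\<mu> ^ l * \<phi> r)"]
      weights_sum[OF r_in, of l] weight_nonneg[OF r_in] r_in finite_V by (simp add: w_def)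
  then have \<epsilon>_le: "\<epsilon> \<le> 1" using mass[OF C(2)] by simp
  \<comment> \<open>A crude bound for all densities on the class during the initial block
    \<open>k < l\<close>, where the induction starts.\<close>
  define B where "B = (\<Sum>k<l. \<Sum>x\<in>C. density y k x)"
  define b where "b k = (1 - \<epsilon>) ^ (k div l) * B" for k
  have "filterlim (\<lambda>k. k div l) at_top sequentially"
    unfolding filterlim_at_top
  proof
    fix Z show "\<forall>\<^sub>F k in sequentially. Z \<le> k div l"
      using eventually_ge_at_top[of "Z * l"]
      by eventually_elim (use l div_le_mono[of "Z * l" _ l] in simp)
  qed
  moreover have "(\<lambda>j. (1 - \<epsilon>) ^ j) \<longlonglongrightarrow> 0" using \<epsilon>_pos \<epsilon>_le by (intro LIMSEQ_realpow_zero) auto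
  ultimately have "(\<lambda>k. (1 - \<epsilon>) ^ (k div l)) \<longlonglongrightarrow> 0" by (rule filterlim_compose[rotated])
  then have "b \<longlonglongrightarrow> 0" unfolding b_def by (rule tendsto_mult_left_zero)
  moreover have "\<exists>a. \<forall>x\<in>V. colour x = colour r \<longrightarrow> density y k x \<in> {a..a + b k}" for k
  proof (induction k rule: less_induct)
    case (less k)
    show ?case
    proof (cases "k < l")
      case True
      have "density y k x \<in> {0..0 + b k}" if "x \<in> V" "colour x = colour r" for x
      proof -
        have "density y k x \<le> (\<Sum>x\<in>C. density y k x)"
          using that C density_nonneg by (intro member_le_sum) (auto simp: C_def)
        also have "\<dots> \<le> B" unfolding B_def using True density_nonneg
          by (intro member_le_sum[of k _ "\<lambda>k. \<Sum>x\<in>C. density y k x"] sum_nonneg) (auto simp: C_def)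
        finally show ?thesis using True density_nonneg[OF that(1)] by (simp add: b_def)
      qed
      then show ?thesis by blast
    next
      case False
      then obtain j where j: "k = l + j" using le_Suc_ex by (metis not_less)
      obtain a where a: "\<And>x. x \<in> V \<Longrightarrow> colour x = colour r \<Longrightarrow> density y j x \<in> {a..a + b j}"
        using less[of j] j l by auto
      have "b k = (1 - \<epsilon>) * b j" unfolding b_def j using l by simp
      then show ?thesis
        unfolding j using density_contract[OF l(2) \<epsilon>_pos, of y j a "b j"] mass a
        by (simp add: w_def C_def)
    qed
  qed
  ultimately show thesis by (rule that)
qed

text \<open>The chain has stationary measure \<open>\<phi>\<^sup>2\<close>, so the total mass of the
  density is independent of \<open>k\<close>. It sits on the one colour class from which
  \<open>y\<close> is reachable in \<open>k\<close> steps, and it identifies the limit once the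
  oscillation is known to vanish.\<close>

lemma density_mass:
  assumes y: "y \<in> V" and b: "b = (even k = colour y)"
  shows "(\<Sum>x | x \<in> V \<and> colour x = b. (\<phi> x)\<^sup>2 * density y k x) = \<phi> y"
proof -
  have "(\<Sum>x | x \<in> V \<and> colour x = b. (\<phi> x)\<^sup>2 * density y k x) = (\<Sum>x\<in>V. (\<phi> x)\<^sup>2 * density y k x)"
    using walk_count_colour[of _ k y] b
    by (intro sum.mono_neutral_left) (auto simp: finite_V density_def)
  also have "\<dots> = (\<Sum>x\<in>V. \<phi> x * walk_count E k x y / \<mu> ^ k)"
    using \<phi>_pos by (intro sum.cong refl) (auto simp: density_def power2_eq_square less_imp_neq[symmetric])
  also have "\<dots> = \<phi> y"
    using eigen_walk_count[OF y, of k] \<mu>_pos by (simp add: sum_divide_distrib[symmetric])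
  finally show ?thesis .
qed

theorem walk_count_asymptotics:
  assumes x: "x \<in> V" and y: "y \<in> V"
  shows "((\<lambda>k. walk_count E k x y / \<mu> ^ k) \<longlongrightarrow> 2 * \<phi> x * \<phi> y / (\<Sum>z\<in>V. (\<phi> z)\<^sup>2))
     (inf at_top (principal {k. even k = (colour x = colour y)}))"
proof -
  define N where "N = (\<Sum>z\<in>V. (\<phi> z)\<^sup>2)"
  \<comment> \<open>The conserved mass \<open>\<phi> y\<close> divided by the norm
    \<open>N / 2\<close> of one colour class.\<close>
  define c where "c = 2 * \<phi> y / N"
  obtain b where b: "b \<longlonglongrightarrow> 0"
    "\<And>k. \<exists>a. \<forall>x\<in>V. colour x = colour r \<longrightarrow> density y k x \<in> {a..a + b k}"
    using density_oscillation[OF y] by blast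
  have N: "N > 0" unfolding N_def using r_in \<phi>_pos[OF r_in] finite_V
    by (intro sum_pos2[of _ r]) auto
  have close_r: "\<bar>density y k z - c\<bar> \<le> b k"
    if z: "z \<in> V" "colour z = colour r" and k: "even k = (colour z = colour y)" for k z
  proof -
    obtain a where a: "\<And>x. x \<in> V \<Longrightarrow> colour x = colour r \<Longrightarrow> density y k x \<in> {a..a + b k}"
      using b(2)[of k] by blast
    have mass: "(\<Sum>x | x \<in> V \<and> colour x = colour r. (\<phi> x)\<^sup>2 * density y k x) = \<phi> y"
      using z k by (intro density_mass[OF y]) auto
    have norm: "(\<Sum>x | x \<in> V \<and> colour x = colour r. (\<phi> x)\<^sup>2) = N / 2"
      unfolding N_def by (rule norm_colour_classes)
    have "(\<Sum>x | x \<in> V \<and> colour x = colour r. (\<phi> x)\<^sup>2 * density y k x)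
        \<ge> (\<Sum>x | x \<in> V \<and> colour x = colour r. (\<phi> x)\<^sup>2 * a)"
      using a by (intro sum_mono mult_left_mono) auto
    then have 1: "\<phi> y \<ge> N / 2 * a" unfolding mass norm sum_distrib_right[symmetric] .
    have "(\<Sum>x | x \<in> V \<and> colour x = colour r. (\<phi> x)\<^sup>2 * density y k x)
        \<le> (\<Sum>x | x \<in> V \<and> colour x = colour r. (\<phi> x)\<^sup>2 * (a + b k))"
      using a by (intro sum_mono mult_left_mono) auto
    then have 2: "\<phi> y \<le> N / 2 * (a + b k)" unfolding mass norm sum_distrib_right[symmetric] .
    \<comment> \<open>Being the weighted mean of the densities on the class, \<open>c\<close> lies
      in every interval that contains them all, so its distance to each is at most the
      width.\<close>
    have "c \<in> {a..a + b k}" using 1 2 N by (auto simp: c_def field_simps)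
    then show ?thesis using a[OF z] by auto
  qed
  \<comment> \<open>A vertex in the class opposite to \<open>r\<close> averages, after one step,
    over the class of \<open>r\<close> at time \<open>k\<close>; the maximum covers both positions
    of \<open>x\<close>.\<close>
  have close: "\<bar>density y (Suc k) x - c\<bar> \<le> max (b k) (b (Suc k))"
    if k: "even (Suc k) = (colour x = colour y)" for k
  proof (cases "colour x = colour r")
    case True
    then show ?thesis using close_r[of x "Suc k"] x k by auto
  next
    case False
    have *: "\<bar>density y k z - c\<bar> \<le> b k" if "z \<in> V" "colour z = (colour x = even (1::nat))" for z
      using close_r[of z k] that k False by auto
    have "density y (1 + k) x \<le> c + b k" "density y (1 + k) x \<ge> c - b k"
      using * by (auto intro!: density_le density_ge x simp: abs_le_iff simp del: One_nat_def) fastforce+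
    then show ?thesis by auto
  qed
  let ?F = "inf at_top (principal {k. even k = (colour x = colour y)})"
  have lim: "(\<lambda>k. max (b (k - 1)) (b k)) \<longlonglongrightarrow> 0"
  proof -
    have "(\<lambda>k. max (b k) (b (Suc k))) \<longlonglongrightarrow> max 0 0"
      by (intro tendsto_max b(1) LIMSEQ_Suc)
    then show ?thesis by (subst filterlim_sequentially_Suc[symmetric]) simp
  qed
  have "((\<lambda>k. density y k x - c) \<longlongrightarrow> 0) ?F"
  proof (rule Lim_null_comparison)
    show "((\<lambda>k. max (b (k - 1)) (b k)) \<longlongrightarrow> 0) ?F"
      using lim by (rule tendsto_mono[rotated]) simp
    show "\<forall>\<^sub>F k in ?F. norm (density y k x - c) \<le> max (b (k - 1)) (b k)"
      unfolding eventually_inf_principal using eventually_gt_at_top[of 0]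
    proof eventually_elim
      case (elim k)
      then show ?case using close[of "k - 1"] by auto
    qed
  qed
  then have "((\<lambda>k. density y k x) \<longlongrightarrow> c) ?F" by (simp add: LIM_zero_iff)
  then have "((\<lambda>k. \<phi> x * density y k x) \<longlongrightarrow> \<phi> x * c) ?F" by (rule tendsto_mult_left)
  moreover have "\<phi> x * density y k x = walk_count E k x y / \<mu> ^ k" for k
    using \<phi>_pos[OF x] by (simp add: density_def)
  moreover have "\<phi> x * c = 2 * \<phi> x * \<phi> y / (\<Sum>z\<in>V. (\<phi> z)\<^sup>2)"
    by (simp add: c_def N_def)
  ultimately show ?thesis by simp
qed

end

section \<open>Cosine determinants\<close>

fun chebyshev :: "nat \<Rightarrow> real poly" where
  "chebyshev 0 = 1"
| "chebyshev (Suc 0) = [:0, 1:]"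
| "chebyshev (Suc (Suc n)) = pCons 0 (Polynomial.smult 2 (chebyshev (Suc n))) - chebyshev n"

lemma poly_chebyshev_cos: "poly (chebyshev n) (cos t) = cos (real n * t)"
proof (induction n rule: chebyshev.induct)
  case (3 n)
  have "cos (real (Suc (Suc n)) * t) + cos (real n * t) = 2 * cos t * cos (real (Suc n) * t)"
    using cos_plus_cos[of "real (Suc (Suc n)) * t" "real n * t"]
    by (simp add: algebra_simps add_divide_distrib)
  then show ?case using 3 by simp
qed auto

lemma degree_chebyshev: "degree (chebyshev n) \<le> n"
  by (induction n rule: chebyshev.induct)
    (auto intro!: degree_diff_le simp: degree_pCons_eq_if)

lemma coeff_chebyshev: "coeff (chebyshev n) n = (if n = 0 then 1 else 2 ^ (n - 1))"
proof (induction n rule: chebyshev.induct)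
  case (3 n)
  have "coeff (chebyshev n) (Suc (Suc n)) = 0"
    using degree_chebyshev[of n] by (intro coeff_eq_0) simp
  then show ?case using 3 by simp
qed auto

abbreviation eval_mat :: "nat \<Rightarrow> (nat \<Rightarrow> 'b \<Rightarrow> 'a) \<Rightarrow> (nat \<Rightarrow> 'b) \<Rightarrow> 'a mat" where
  "eval_mat n g c \<equiv> mat n n (\<lambda>(i, j). g j (c i))"

text \<open>Passing from monomials to the \<open>P j\<close> multiplies the matrix on the right by
  the coefficient matrix, which is triangular by the degree bound. It serves for the Newton basis
  and for the Chebyshev polynomials.\<close>

lemma det_eval_poly:
  fixes P :: "nat \<Rightarrow> 'a :: comm_ring_1 poly"
  assumes deg: "\<And>j. j < n \<Longrightarrow> degree (P j) \<le> j"
  shows "Determinant.det (eval_mat n (\<lambda>j. poly (P j)) c) =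
         Determinant.det (eval_mat n (\<lambda>j x. x ^ j) c) * (\<Prod>j<n. coeff (P j) j)"
proof -
  define U where "U = mat n n (\<lambda>(k, j). coeff (P j) k)"
  have U: "U \<in> carrier_mat n n" unfolding U_def by simp
  have "eval_mat n (\<lambda>j. poly (P j)) c = eval_mat n (\<lambda>j x. x ^ j) c * U"
  proof (rule eq_matI)
    fix i j assume "i < dim_row (eval_mat n (\<lambda>j x. x ^ j) c * U)"
      and "j < dim_col (eval_mat n (\<lambda>j x. x ^ j) c * U)"
    then have ij: "i < n" "j < n" by (auto simp: U_def)
    have "poly (P j) (c i) = (\<Sum>k<n. coeff (P j) k * c i ^ k)"
      unfolding poly_altdef using deg[OF ij(2)] ij coeff_eq_0[of "P j"]
      by (intro sum.mono_neutral_left) (auto simp: not_le)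
    then show "eval_mat n (\<lambda>j. poly (P j)) c $$ (i, j) = (eval_mat n (\<lambda>j x. x ^ j) c * U) $$ (i, j)"
      using ij by (simp add: U_def scalar_prod_def atLeast0LessThan mult.commute)
  qed (auto simp: U_def)
  moreover have "Determinant.det U = (\<Prod>j<n. coeff (P j) j)"
  proof -
    have "upper_triangular U"
      unfolding upper_triangular_def U_def by (auto intro!: coeff_eq_0 le_less_trans[OF deg])
    from det_upper_triangular[OF this U] show ?thesis
      by (simp add: prod_list_diag_prod U_def atLeast0LessThan)
  qed
  ultimately show ?thesis by (simp add: det_mult[OF _ U])
qed

text \<open>In the Newton basis the evaluation matrix is triangular.\<close>

lemma det_vandermonde:
  fixes c :: "nat \<Rightarrow> 'a :: idom"
  shows "Determinant.det (eval_mat n (\<lambda>j x. x ^ j) c) = (\<Prod>j<n. \<Prod>i<j. c j - c i)"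
proof -
  define N where "N j = (\<Prod>i<j. [:- c i, 1:])" for j
  have deg: "degree (N j) = j" for j
    unfolding N_def by (subst degree_prod_eq_sum_degree) auto
  have lead: "coeff (N j) j = 1" for j
    using lead_coeff_prod[of "\<lambda>i. [:- c i, 1:]" "{..<j}"] deg[of j] by (simp add: N_def)
  have val: "poly (N j) x = (\<Prod>i<j. x - c i)" for j x
    unfolding N_def poly_prod by simp
  have "Determinant.det (eval_mat n (\<lambda>j. poly (N j)) c) = (\<Prod>j<n. poly (N j) (c j))"
    by (subst det_lower_triangular[of n])
      (auto simp: val prod_list_diag_prod atLeast0LessThan)
  moreover have "Determinant.det (eval_mat n (\<lambda>j. poly (N j)) c) =
      Determinant.det (eval_mat n (\<lambda>j x. x ^ j) c)"
    by (subst det_eval_poly) (auto simp: deg lead)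
  ultimately show ?thesis by (simp add: val)
qed

definition cos_det :: "nat \<Rightarrow> (nat \<Rightarrow> real) \<Rightarrow> real" where
  "cos_det n \<theta> = Determinant.det (eval_mat n (\<lambda>j t. cos (real j * t)) \<theta>)"

lemma cos_det_leibniz:
  "cos_det n \<theta> = (\<Sum>p | p permutes {0..<n}. of_int (sign p) * (\<Prod>i=0..<n. cos (real (p i) * \<theta> i)))"
proof -
  have "(\<Prod>i=0..<n. eval_mat n (\<lambda>j t. cos (real j * t)) \<theta> $$ (i, p i)) =
      (\<Prod>i=0..<n. cos (real (p i) * \<theta> i))" if "p permutes {0..<n}" for p
    using permutes_in_image[OF that] by (intro prod.cong refl) auto
  then show ?thesis unfolding cos_det_def by (subst det_def'[of _ n]) auto
qed

text \<open>Since \<open>cos (j t)\<close> is the Chebyshev polynomial of index \<open>j\<close> at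
  \<open>cos t\<close>, this is a Vandermonde determinant in the \<open>cos (\<theta> i)\<close>,
  and each difference of cosines is twice a product of sines. Column \<open>j \<ge> 1\<close>
  contributes \<open>2 ^ j\<close> from the differences and \<open>2 ^ (j - 1)\<close> from the
  leading coefficient; the odd exponents \<open>2 j - 1\<close> add up to
  \<open>(n - 1)\<^sup>2\<close>.\<close>

lemma cos_det_product:
  assumes "n \<ge> 1"
  shows "cos_det n \<theta> =
    2 ^ (n - 1)\<^sup>2 * (\<Prod>j<n. \<Prod>i<j. sin ((\<theta> i - \<theta> j) / 2) * sin ((\<theta> i + \<theta> j) / 2))"
proof -
  have "cos_det n \<theta> = Determinant.det (eval_mat n (\<lambda>j. poly (chebyshev j)) (\<lambda>i. cos (\<theta> i)))"
    unfolding cos_det_def by (simp add: poly_chebyshev_cos)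
  also have "\<dots> = (\<Prod>j<n. \<Prod>i<j. cos (\<theta> j) - cos (\<theta> i)) * (\<Prod>j<n. coeff (chebyshev j) j)"
    by (simp add: det_eval_poly degree_chebyshev det_vandermonde)
  also have "(\<Prod>j<n. \<Prod>i<j. cos (\<theta> j) - cos (\<theta> i)) =
      (\<Prod>j<n. 2 ^ j * (\<Prod>i<j. sin ((\<theta> i - \<theta> j) / 2) * sin ((\<theta> i + \<theta> j) / 2)))"
  proof (intro prod.cong refl)
    fix j
    have "cos (\<theta> j) - cos (\<theta> i) = 2 * (sin ((\<theta> i - \<theta> j) / 2) * sin ((\<theta> i + \<theta> j) / 2))" for i
      by (simp add: cos_diff_cos add.commute)
    then show "(\<Prod>i<j. cos (\<theta> j) - cos (\<theta> i)) =
        2 ^ j * (\<Prod>i<j. sin ((\<theta> i - \<theta> j) / 2) * sin ((\<theta> i + \<theta> j) / 2))"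
      by (simp add: prod.distrib)
  qed
  also have "\<dots> * (\<Prod>j<n. coeff (chebyshev j) j) =
      (\<Prod>j<n. 2 ^ j * coeff (chebyshev j) j) *
      (\<Prod>j<n. \<Prod>i<j. sin ((\<theta> i - \<theta> j) / 2) * sin ((\<theta> i + \<theta> j) / 2))"
    by (simp add: prod.distrib mult_ac)
  also have "(\<Prod>j<n. 2 ^ j * coeff (chebyshev j) j) = 2 ^ (n - 1)\<^sup>2"
    using assms
  proof (induction n rule: dec_induct)
    case (step n)
    then obtain k where k: "n = Suc k" by (cases n) auto
    have "(2::real) ^ (Suc k)\<^sup>2 = 2 ^ k\<^sup>2 * (2 * 2 ^ k * 2 ^ k)"
      by (simp add: power2_eq_square power_add)
    with step k show ?case by (simp add: coeff_chebyshev)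
  qed (simp add: coeff_chebyshev)
  finally show ?thesis .
qed

text \<open>Each Leibniz term contains the angle of row \<open>j\<close> in one cosine only, so the
  two opposite shifts multiply the term by \<open>2 * cos (real (p j) * a)\<close>.\<close>

lemma cos_det_update:
  assumes "j < n"
  shows "cos_det n (\<theta>(j := \<theta> j + a)) + cos_det n (\<theta>(j := \<theta> j - a)) =
    (\<Sum>p | p permutes {0..<n}. of_int (sign p) * (2 * cos (real (p j) * a)) *
        (\<Prod>i=0..<n. cos (real (p i) * \<theta> i)))"
proof -
  have upd: "(\<Prod>i=0..<n. cos (real (p i) * (\<theta>(j := v)) i)) =
      cos (real (p j) * v) * (\<Prod>i\<in>{0..<n} - {j}. cos (real (p i) * \<theta> i))" for p v
    using assms by (subst prod.remove[of _ j]) (auto intro!: prod.cong)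
  have sum2: "cos (real k * (t + a)) + cos (real k * (t - a)) = 2 * cos (real k * a) * cos (real k * t)"
    for k t by (simp add: cos_add cos_diff algebra_simps)
  show ?thesis
    unfolding cos_det_leibniz sum.distrib[symmetric] upd
  proof (intro sum.cong refl)
    fix p
    have "(\<Prod>i=0..<n. cos (real (p i) * \<theta> i)) =
        cos (real (p j) * \<theta> j) * (\<Prod>i\<in>{0..<n} - {j}. cos (real (p i) * \<theta> i))"
      using assms by (intro prod.remove) auto
    then show "of_int (sign p) * (cos (real (p j) * (\<theta> j + a)) * (\<Prod>i\<in>{0..<n} - {j}. cos (real (p i) * \<theta> i))) +
         of_int (sign p) * (cos (real (p j) * (\<theta> j - a)) * (\<Prod>i\<in>{0..<n} - {j}. cos (real (p i) * \<theta> i))) =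
         of_int (sign p) * (2 * cos (real (p j) * a)) * (\<Prod>i=0..<n. cos (real (p i) * \<theta> i))"
      by (simp add: distrib_left[symmetric] distrib_right[symmetric] sum2 mult_ac)
  qed
qed

text \<open>The multiplier of a single Leibniz term depends on \<open>p j\<close>, but summed over
  all rows \<open>j\<close> it is the same for every permutation \<open>p\<close> and factors
  out.\<close>

lemma cos_det_eigen:
  "(\<Sum>j<n. cos_det n (\<theta>(j := \<theta> j + a)) + cos_det n (\<theta>(j := \<theta> j - a))) =
   (\<Sum>j<n. 2 * cos (real j * a)) * cos_det n \<theta>"
proof -
  have perm: "(\<Sum>j<n. 2 * cos (real (p j) * a)) = (\<Sum>j<n. 2 * cos (real j * a))"
    if "p permutes {0..<n}" for p
    using sum.permute[OF that, of "\<lambda>j. 2 * cos (real j * a)"] by (simp add: atLeast0LessThan o_def)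
  have "(\<Sum>j<n. cos_det n (\<theta>(j := \<theta> j + a)) + cos_det n (\<theta>(j := \<theta> j - a))) =
    (\<Sum>p | p permutes {0..<n}. \<Sum>j<n. of_int (sign p) * (2 * cos (real (p j) * a)) *
        (\<Prod>i=0..<n. cos (real (p i) * \<theta> i)))"
    by (subst sum.swap) (simp add: cos_det_update)
  also have "\<dots> = (\<Sum>p | p permutes {0..<n}. (\<Sum>j<n. 2 * cos (real j * a)) * (of_int (sign p) *
        (\<Prod>i=0..<n. cos (real (p i) * \<theta> i))))"
  proof (intro sum.cong refl)
    have pull: "(\<Sum>j<n. c * f j * d) = (\<Sum>j<n. f j) * (c * d)" for c d :: real and f
      by (simp add: sum_distrib_left sum_distrib_right mult_ac)
    fix p assume "p \<in> {p. p permutes {0..<n}}"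
    then have p: "(\<Sum>j<n. 2 * cos (real (p j) * a)) = (\<Sum>j<n. 2 * cos (real j * a))"
      by (simp only: perm mem_Collect_eq)
    show "(\<Sum>j<n. of_int (sign p) * (2 * cos (real (p j) * a)) * (\<Prod>i=0..<n. cos (real (p i) * \<theta> i))) =
        (\<Sum>j<n. 2 * cos (real j * a)) * (of_int (sign p) * (\<Prod>i=0..<n. cos (real (p i) * \<theta> i)))"
      by (simp only: pull p)
  qed
  finally show ?thesis by (simp add: cos_det_leibniz sum_distrib_left)
qed

section \<open>Squared determinants and discrete orthogonality\<close>

text \<open>A discrete Andreief identity. After both determinants are expanded, the sum over tuples
  factors into one inner product per row, and orthogonality leaves only the diagonal pairs
  \<open>p = q\<close>.\<close>

lemma sum_det_squared:
  fixes g :: "nat \<Rightarrow> 'b \<Rightarrow> real" and u :: "'b \<Rightarrow> real"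
  assumes fin: "finite S"
    and orth: "\<And>a b. a < n \<Longrightarrow> b < n \<Longrightarrow> (\<Sum>s\<in>S. u s * (g a s * g b s)) = (if a = b then G a else 0)"
  shows "(\<Sum>y\<in>{0..<n} \<rightarrow>\<^sub>E S. (\<Prod>i=0..<n. u (y i)) * (Determinant.det (eval_mat n g y))\<^sup>2) =
     fact n * (\<Prod>j<n. G j)"
proof -
  let ?P = "{p. p permutes {0..<n}}"
  have det: "Determinant.det (eval_mat n g y) = (\<Sum>p\<in>?P. of_int (sign p) * (\<Prod>i=0..<n. g (p i) (y i)))" for y
  proof -
    have "(\<Prod>i=0..<n. eval_mat n g y $$ (i, p i)) = (\<Prod>i=0..<n. g (p i) (y i))" if "p permutes {0..<n}" for p
      using permutes_in_image[OF that] by (intro prod.cong refl) auto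
    then show ?thesis by (subst det_def'[of _ n]) auto
  qed
  have pair: "(\<Sum>y\<in>{0..<n} \<rightarrow>\<^sub>E S. \<Prod>i=0..<n. u (y i) * (g (p i) (y i) * g (q i) (y i))) =
      (if p = q then \<Prod>j<n. G j else 0)" if p: "p permutes {0..<n}" and q: "q permutes {0..<n}" for p q
  proof -
    have "(\<Sum>y\<in>{0..<n} \<rightarrow>\<^sub>E S. \<Prod>i=0..<n. u (y i) * (g (p i) (y i) * g (q i) (y i))) =
       (\<Prod>i=0..<n. \<Sum>s\<in>S. u s * (g (p i) s * g (q i) s))"
      by (rule prod_sum_PiE[symmetric]) (auto simp: fin)
    also have "\<dots> = (\<Prod>i=0..<n. if p i = q i then G (p i) else 0)"
      using permutes_in_image[OF p] permutes_in_image[OF q] by (intro prod.cong refl orth) auto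
    also have "\<dots> = (if p = q then \<Prod>j<n. G j else 0)"
    proof (cases "p = q")
      case True
      then show ?thesis using prod.permute[OF p, of G] by (simp add: atLeast0LessThan o_def)
    next
      case False
      then obtain i where "p i \<noteq> q i" by auto
      moreover from this have "i \<in> {0..<n}" using p q by (metis permutes_not_in)
      ultimately show ?thesis using False by (auto intro!: prod_zero)
    qed
    finally show ?thesis .
  qed
  have sq: "(of_int (sign p) * of_int (sign p) :: real) = 1" for p :: "nat \<Rightarrow> nat"
    by (simp add: sign_def)
  have "(\<Sum>y\<in>{0..<n} \<rightarrow>\<^sub>E S. (\<Prod>i=0..<n. u (y i)) * (Determinant.det (eval_mat n g y))\<^sup>2) =
    (\<Sum>y\<in>{0..<n} \<rightarrow>\<^sub>E S. \<Sum>p\<in>?P. \<Sum>q\<in>?P. of_int (sign p) * of_int (sign q) *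
       (\<Prod>i=0..<n. u (y i) * (g (p i) (y i) * g (q i) (y i))))"
  proof (intro sum.cong refl)
    fix y
    have "(\<Prod>i=0..<n. u (y i)) * (Determinant.det (eval_mat n g y))\<^sup>2 =
       (\<Sum>p\<in>?P. \<Sum>q\<in>?P. (\<Prod>i=0..<n. u (y i)) * ((of_int (sign p) * (\<Prod>i=0..<n. g (p i) (y i))) *
          (of_int (sign q) * (\<Prod>i=0..<n. g (q i) (y i)))))"
      unfolding det power2_eq_square sum_product by (simp only: sum_distrib_left)
    then show "(\<Prod>i=0..<n. u (y i)) * (Determinant.det (eval_mat n g y))\<^sup>2 =
       (\<Sum>p\<in>?P. \<Sum>q\<in>?P. of_int (sign p) * of_int (sign q) *
         (\<Prod>i=0..<n. u (y i) * (g (p i) (y i) * g (q i) (y i))))"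
      by (simp add: prod.distrib mult_ac)
  qed
  also have "\<dots> = (\<Sum>p\<in>?P. \<Sum>q\<in>?P. of_int (sign p) * of_int (sign q) *
      (\<Sum>y\<in>{0..<n} \<rightarrow>\<^sub>E S. \<Prod>i=0..<n. u (y i) * (g (p i) (y i) * g (q i) (y i))))"
    by (subst sum.swap, intro sum.cong refl, subst sum.swap) (simp add: sum_distrib_left)
  also have "\<dots> = (\<Sum>p\<in>?P. \<Sum>q\<in>?P. if p = q then \<Prod>j<n. G j else 0)"
    by (intro sum.cong refl) (simp add: pair sq)
  also have "\<dots> = fact n * (\<Prod>j<n. G j)"
    using card_permutations[of "{0..<n}" n] by (simp add: finite_permutations)
  finally show ?thesis .
qed

text \<open>Each \<open>n\<close>-element set is the image of \<open>n!\<close> injective tuples;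
  this factor cancels the one in \<open>sum_det_squared\<close>.\<close>

lemma sum_inj_funcset_image:
  fixes F :: "'b set \<Rightarrow> real"
  assumes fin: "finite S" and nz: "\<And>y. y \<in> {0..<n} \<rightarrow>\<^sub>E S \<Longrightarrow> f y \<noteq> 0 \<Longrightarrow> inj_on y {0..<n}"
    and f: "\<And>y. y \<in> {0..<n} \<rightarrow>\<^sub>E S \<Longrightarrow> inj_on y {0..<n} \<Longrightarrow> f y = F (y ` {0..<n})"
  shows "(\<Sum>y\<in>{0..<n} \<rightarrow>\<^sub>E S. f y) = fact n * (\<Sum>Y | Y \<subseteq> S \<and> card Y = n. F Y)"
proof -
  define I where "I = {y \<in> {0..<n} \<rightarrow>\<^sub>E S. inj_on y {0..<n}}"
  have finPi: "finite ({0..<n} \<rightarrow>\<^sub>E S)" using fin by (simp add: finite_PiE)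
  then have finI: "finite I" unfolding I_def by simp
  have "(\<Sum>y\<in>{0..<n} \<rightarrow>\<^sub>E S. f y) = (\<Sum>y\<in>I. f y)"
    using nz finPi by (intro sum.mono_neutral_right) (auto simp: I_def)
  also have "\<dots> = (\<Sum>Y | Y \<subseteq> S \<and> card Y = n. \<Sum>y | y \<in> I \<and> y ` {0..<n} = Y. f y)"
    using fin finI by (intro sum.group[symmetric]) (auto simp: I_def card_image PiE_mem)
  also have "\<dots> = (\<Sum>Y | Y \<subseteq> S \<and> card Y = n. fact n * F Y)"
  proof (intro sum.cong refl)
    fix Y assume "Y \<in> {Y. Y \<subseteq> S \<and> card Y = n}"
    then have Y: "Y \<subseteq> S" "card Y = n" "finite Y" using fin finite_subset by auto
    have "{y \<in> I. y ` {0..<n} = Y} = {y \<in> {0..<n} \<rightarrow>\<^sub>E Y. inj_on y {0..<n}}" (is "?L = ?R")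
    proof (intro equalityI subsetI)
      fix y assume "y \<in> ?R"
      moreover from this have "y ` {0..<n} = Y"
        using Y by (intro card_subset_eq) (auto simp: card_image)
      ultimately show "y \<in> ?L" using Y by (auto simp: I_def PiE_def Pi_def)
    qed (auto simp: I_def PiE_def Pi_def)
    moreover have "card ?R = fact n"
      using card_inj_on_subset_funcset[of "{0..<n}" Y "{0..<n}"] Y by (simp add: fact_prod_rev)
    ultimately have "card ?L = fact n" by simp
    moreover have "(\<Sum>y\<in>?L. f y) = (\<Sum>y\<in>?L. F Y)"
      using f by (intro sum.cong refl) (auto simp: I_def)
    ultimately show "(\<Sum>y\<in>?L. f y) = fact n * F Y" by simp
  qed
  finally show ?thesis by (simp add: sum_distrib_left)
qed

text \<open>Weights of the trapezoidal rule on \<open>{0..m}\<close>.\<close>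

definition end_weight :: "nat \<Rightarrow> nat \<Rightarrow> real" where
  "end_weight m y = (if y = 0 \<or> y = m then 1 / 2 else 1)"

lemma trapezoid_sum:
  assumes "m \<ge> 1"
  shows "(\<Sum>y\<le>m. end_weight m y * f y) = (\<Sum>y<m. f y + f (Suc y)) / 2"
proof -
  obtain k where k: "m = Suc k" using assms by (cases m) auto
  have 1: "(\<Sum>y<Suc k. f y) = f 0 + (\<Sum>y<k. f (Suc y))" by (rule sum.lessThan_Suc_shift)
  have 2: "(\<Sum>y\<le>Suc k. end_weight m y * f y) = f 0 / 2 + (\<Sum>y<k. f (Suc y)) + f (Suc k) / 2"
  proof -
    have "(\<Sum>y\<le>Suc k. end_weight m y * f y) = (\<Sum>y<Suc (Suc k). end_weight m y * f y)"
      by (simp add: lessThan_Suc_atMost)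
    also have "\<dots> = (\<Sum>y<Suc k. end_weight m y * f y) + f (Suc k) / 2"
      by (simp add: end_weight_def k)
    also have "(\<Sum>y<Suc k. end_weight m y * f y) = f 0 / 2 + (\<Sum>y<k. end_weight m (Suc y) * f (Suc y))"
      by (subst sum.lessThan_Suc_shift) (simp add: end_weight_def k)
    also have "(\<Sum>y<k. end_weight m (Suc y) * f (Suc y)) = (\<Sum>y<k. f (Suc y))"
      by (intro sum.cong refl) (auto simp: end_weight_def k)
    finally show ?thesis .
  qed
  show ?thesis using 1 2 by (simp add: k sum.distrib)
qed

text \<open>With \<open>\<alpha> = d pi / m\<close>, multiplication by
  \<open>sin (\<alpha> / 2)\<close> makes the sum of adjacent cosines telescope to a multiple of
  \<open>sin (d pi) = 0\<close>. The bound \<open>d < 2 * m\<close> keeps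
  \<open>\<alpha> / 2\<close> strictly between 0 and \<open>pi\<close>, so the multiplier can be
  cancelled.\<close>

lemma trapezoid_cos:
  assumes "d < 2 * m"
  shows "(\<Sum>y\<le>m. end_weight m y * cos (real d * (real y * pi / real m))) = (if d = 0 then real m else 0)"
proof -
  have m: "m \<ge> 1" using assms by simp
  show ?thesis
  proof (cases "d = 0")
    case True
    then show ?thesis using m by (subst trapezoid_sum) auto
  next
    case False
    define \<alpha> where "\<alpha> = real d * pi / real m"
    have "sin (\<alpha> / 2) > 0"
      unfolding \<alpha>_def using False assms m by (intro sin_gt_zero) (auto simp: field_simps)
    moreover have "sin (\<alpha> / 2) * (cos (\<alpha> * real y) + cos (\<alpha> * real (Suc y))) =
        cos (\<alpha> / 2) * (sin (\<alpha> * real (Suc y)) - sin (\<alpha> * real y))" for y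
    proof -
      have a: "cos (\<alpha> * real y) + cos (\<alpha> * real (Suc y)) = 2 * cos (\<alpha> * (real y + 1/2)) * cos (\<alpha> / 2)"
        using cos_plus_cos[of "\<alpha> * real (Suc y)" "\<alpha> * real y"]
        by (simp add: algebra_simps add_divide_distrib)
      have b: "sin (\<alpha> * real (Suc y)) - sin (\<alpha> * real y) = 2 * sin (\<alpha> / 2) * cos (\<alpha> * (real y + 1/2))"
        using sin_diff_sin[of "\<alpha> * real (Suc y)" "\<alpha> * real y"]
        by (simp add: algebra_simps add_divide_distrib)
      show ?thesis unfolding a b by simp
    qed
    then have "sin (\<alpha> / 2) * (\<Sum>y<m. cos (\<alpha> * real y) + cos (\<alpha> * real (Suc y))) =
        cos (\<alpha> / 2) * (\<Sum>y<m. sin (\<alpha> * real (Suc y)) - sin (\<alpha> * real y))"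
      unfolding sum_distrib_left by simp
    moreover have "(\<Sum>y<m. sin (\<alpha> * real (Suc y)) - sin (\<alpha> * real y)) = 0"
    proof -
      have "\<alpha> * real m = real d * pi" unfolding \<alpha>_def using m by simp
      then have "sin (\<alpha> * real m) = 0" by (simp only: sin_npi)
      then show ?thesis by (subst sum_lessThan_telescope) simp
    qed
    ultimately have "sin (\<alpha> / 2) * (\<Sum>y<m. cos (\<alpha> * real y) + cos (\<alpha> * real (Suc y))) = 0"
      by (simp only: mult_zero_right)
    then have "(\<Sum>y<m. cos (\<alpha> * real y) + cos (\<alpha> * real (Suc y))) = 0"
      using \<open>sin (\<alpha> / 2) > 0\<close> by (simp only: mult_eq_0_iff) auto
    moreover have "(\<Sum>y\<le>m. end_weight m y * cos (real d * (real y * pi / real m))) =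
        (\<Sum>y<m. cos (\<alpha> * real y) + cos (\<alpha> * real (Suc y))) / 2"
      using trapezoid_sum[OF m, of "\<lambda>y. cos (real d * (real y * pi / real m))"]
      by (simp add: \<alpha>_def mult_ac)
    ultimately show ?thesis using False by simp
  qed
qed

text \<open>The product of cosines splits into halves of frequency \<open>b - a\<close> and
  \<open>a + b\<close>, both below \<open>2 * m\<close>. At \<open>a = b = 0\<close> both halves
  survive, which doubles the norm.\<close>

lemma trapezoid_cos_orthogonal:
  assumes "a < m" "b < m"
  shows "(\<Sum>y\<le>m. end_weight m y * (cos (real a * (real y * pi / real m)) * cos (real b * (real y * pi / real m)))) =
    (if a = b then if a = 0 then real m else real m / 2 else 0)"
  using assms
proof (induction a b rule: linorder_wlog)
  case (le a b)
  define t where "t y = real y * pi / real m" for y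
  have "cos (real a * t y) * cos (real b * t y) =
      cos (real (b - a) * t y) / 2 + cos (real (a + b) * t y) / 2" for y
    using le by (simp add: cos_times_cos of_nat_diff algebra_simps add_divide_distrib)
      (metis cos_minus minus_diff_eq)
  then have "(\<Sum>y\<le>m. end_weight m y * (cos (real a * t y) * cos (real b * t y))) =
      (\<Sum>y\<le>m. end_weight m y * cos (real (b - a) * t y)) / 2 +
      (\<Sum>y\<le>m. end_weight m y * cos (real (a + b) * t y)) / 2"
    by (simp add: sum.distrib sum_divide_distrib distrib_left)
  also have "\<dots> = (if b - a = 0 then real m else 0) / 2 + (if a + b = 0 then real m else 0) / 2"
    unfolding t_def using le by (subst (1 2) trapezoid_cos) auto
  also have "\<dots> = (if a = b then if a = 0 then real m else real m / 2 else 0)"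
    using le by auto
  finally show ?case unfolding t_def .
next
  case (sym a b)
  then show ?case by (auto simp: mult.commute)
qed

text \<open>The value of \<open>(cos_det n \<theta>)\<^sup>2\<close> at a point whose angles are the \<open>y * pi / m\<close> for \<open>y \<in> Y\<close>,
  taken in any order.\<close>

definition set_det_sq :: "nat \<Rightarrow> nat set \<Rightarrow> real" where
  "set_det_sq m Y = 4 ^ ((card Y - 1)\<^sup>2) *
     (\<Prod>a\<in>Y. \<Prod>b\<in>Y - {a}. \<bar>sin ((real a - real b) * pi / (2 * real m)) * sin ((real a + real b) * pi / (2 * real m))\<bar>)"


text \<open>Ordered off-diagonal pairs meet each unordered pair twice. This is how
  \<open>set_det_sq\<close> expresses a square without choosing an order on its set.\<close>

lemma prod_offdiag_symmetric:
  fixes g :: "nat \<Rightarrow> nat \<Rightarrow> 'a :: comm_monoid_mult"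
  assumes "\<And>i j. g i j = g j i"
  shows "(\<Prod>j<n. \<Prod>i\<in>{..<n} - {j}. g i j) = (\<Prod>j<n. \<Prod>i<j. g i j)\<^sup>2"
proof (induction n)
  case (Suc n)
  have "(\<Prod>i\<in>{..<Suc n} - {j}. g i j) = g n j * (\<Prod>i\<in>{..<n} - {j}. g i j)" if "j < n" for j
  proof -
    have "{..<Suc n} - {j} = insert n ({..<n} - {j})" using that by auto
    then show ?thesis by simp
  qed
  moreover have "{..<Suc n} - {n} = {..<n}" by auto
  moreover have "(\<Prod>j<n. g n j) = (\<Prod>i<n. g i n)" using assms by (intro prod.cong) auto
  ultimately show ?case using Suc by (simp add: prod.distrib power2_eq_square mult_ac)
qed simp

text \<open>Reordering the rows changes the determinant by a sign only. The absolute value in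
  \<open>set_det_sq\<close> makes the factor symmetric in the pair, and the double occurrence of
  each pair supplies the square.\<close>

lemma cos_det_squared:
  assumes "n \<ge> 1" "inj_on y {0..<n}"
  shows "(cos_det n (\<lambda>i. real (y i) * pi / real m))\<^sup>2 = set_det_sq m (y ` {0..<n})"
proof -
  define s where "s a b = \<bar>sin ((real a - real b) * pi / (2 * real m)) * sin ((real a + real b) * pi / (2 * real m))\<bar>"
    for a b :: nat
  have s_sym: "s a b = s b a" for a b
  proof -
    have "(real b - real a) * pi / (2 * real m) = - ((real a - real b) * pi / (2 * real m))"
      by (simp add: algebra_simps diff_divide_distrib)
    then show ?thesis unfolding s_def by (simp add: abs_mult add.commute)
  qed
  have "(\<Prod>a\<in>y ` {0..<n}. \<Prod>b\<in>y ` {0..<n} - {a}. s a b) = (\<Prod>j<n. \<Prod>i\<in>{..<n} - {j}. s (y j) (y i))"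
  proof (subst prod.reindex[OF assms(2)], unfold o_def atLeast0LessThan, rule prod.cong[OF refl])
    fix j assume j: "j \<in> {..<n}"
    have "y ` {..<n} - {y j} = y ` ({..<n} - {j})"
      using assms(2) j by (auto simp: atLeast0LessThan inj_on_def)
    moreover have "inj_on y ({..<n} - {j})"
      using assms(2) by (auto simp: atLeast0LessThan inj_on_def)
    ultimately show "(\<Prod>b\<in>y ` {..<n} - {y j}. s (y j) b) = (\<Prod>i\<in>{..<n} - {j}. s (y j) (y i))"
      by (simp add: prod.reindex)
  qed
  also have "\<dots> = (\<Prod>j<n. \<Prod>i<j. s (y j) (y i))\<^sup>2"
    by (rule prod_offdiag_symmetric) (rule s_sym)
  also have "(\<Prod>j<n. \<Prod>i<j. s (y j) (y i)) =
     \<bar>\<Prod>j<n. \<Prod>i<j. sin ((real (y i) * pi / real m - real (y j) * pi / real m) / 2) *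
        sin ((real (y i) * pi / real m + real (y j) * pi / real m) / 2)\<bar>"
    unfolding abs_prod
  proof (intro prod.cong refl)
    fix j i
    have "s (y j) (y i) = s (y i) (y j)" by (rule s_sym)
    also have "\<dots> = \<bar>sin ((real (y i) * pi / real m - real (y j) * pi / real m) / 2) *
        sin ((real (y i) * pi / real m + real (y j) * pi / real m) / 2)\<bar>"
      unfolding s_def by (simp add: diff_divide_distrib add_divide_distrib algebra_simps)
    finally show "s (y j) (y i) = \<bar>sin ((real (y i) * pi / real m - real (y j) * pi / real m) / 2) *
        sin ((real (y i) * pi / real m + real (y j) * pi / real m) / 2)\<bar>" .
  qed
  finally have prod_eq: "(\<Prod>a\<in>y ` {0..<n}. \<Prod>b\<in>y ` {0..<n} - {a}. s a b) =
     \<bar>\<Prod>j<n. \<Prod>i<j. sin ((real (y i) * pi / real m - real (y j) * pi / real m) / 2) *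
        sin ((real (y i) * pi / real m + real (y j) * pi / real m) / 2)\<bar>\<^sup>2" .
  have four: "((2::real) ^ k)\<^sup>2 = 4 ^ k" for k
    by (simp add: power2_eq_square flip: power_mult_distrib)
  show ?thesis
    unfolding set_det_sq_def s_def cos_det_product[OF assms(1)]
    using assms(2) four prod_eq[unfolded s_def] by (simp add: card_image power_mult_distrib)
qed

lemma sum_set_det_sq:
  assumes "1 \<le> n" "n \<le> m"
  shows "(\<Sum>Y | Y \<subseteq> {..m} \<and> card Y = n. (\<Prod>y\<in>Y. end_weight m y) * set_det_sq m Y) = real m ^ n / 2 ^ (n - 1)"
proof -
  let ?g = "\<lambda>j y. cos (real j * (real y * pi / real m))"
  let ?f = "\<lambda>y. (\<Prod>i=0..<n. end_weight m (y i)) * (Determinant.det (eval_mat n ?g y))\<^sup>2"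
  have det: "Determinant.det (eval_mat n ?g y) = cos_det n (\<lambda>i. real (y i) * pi / real m)" for y
    unfolding cos_det_def by simp
  have "fact n * (\<Prod>j<n. if j = 0 then real m else real m / 2) = (\<Sum>y\<in>{0..<n} \<rightarrow>\<^sub>E {..m}. ?f y)"
    by (rule sum_det_squared[symmetric]) (use trapezoid_cos_orthogonal assms in auto)
  also have "\<dots> = fact n * (\<Sum>Y | Y \<subseteq> {..m} \<and> card Y = n. (\<Prod>y\<in>Y. end_weight m y) * set_det_sq m Y)"
  proof (rule sum_inj_funcset_image)
    fix y assume "y \<in> {0..<n} \<rightarrow>\<^sub>E {..m}" "?f y \<noteq> 0"
    then have nz: "cos_det n (\<lambda>i. real (y i) * pi / real m) \<noteq> 0"
      unfolding det by (intro notI) simp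
    \<comment> \<open>A repeated entry produces a factor \<open>sin 0\<close>, so tuples with
      repetitions contribute nothing.\<close>
    have neq: "y i \<noteq> y j" if "i < j" "j < n" for i j
    proof
      assume "y i = y j"
      then have "cos_det n (\<lambda>i. real (y i) * pi / real m) = 0"
        using that unfolding cos_det_product[OF assms(1)] by force
      with nz show False by simp
    qed
    then show "inj_on y {0..<n}" by (auto simp: inj_on_def) (metis linorder_neqE_nat)
  next
    fix y assume "y \<in> {0..<n} \<rightarrow>\<^sub>E {..m}" "inj_on y {0..<n}"
    then show "?f y = (\<Prod>y\<in>y ` {0..<n}. end_weight m y) * set_det_sq m (y ` {0..<n})"
      unfolding det using cos_det_squared[OF assms(1), of y m] by (simp add: prod.reindex)
  qed simp
  \<comment> \<open>One norm belongs to the constant function, the other \<open>n - 1\<close> to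
    genuine cosines.\<close>
  also have "(\<Prod>j<n. if j = 0 then real m else real m / 2) = real m ^ n / 2 ^ (n - 1)"
  proof -
    obtain k where k: "n = Suc k" using assms by (cases n) auto
    have "(\<Prod>j<n. if j = 0 then real m else real m / 2) = real m * (real m / 2) ^ k"
      unfolding k by (subst prod.lessThan_Suc_shift) simp
    then show ?thesis by (simp add: k power_divide)
  qed
  finally have "real m ^ n / 2 ^ (n - 1) =
      (\<Sum>Y | Y \<subseteq> {..m} \<and> card Y = n. (\<Prod>y\<in>Y. end_weight m y) * set_det_sq m Y)"
    by (rule mult_left_cancel[OF fact_nonzero, THEN iffD1])
  then show ?thesis by (rule sym)
qed

section \<open>The alcove and its eigenfunction\<close>

definition lattice_alcove :: "nat \<Rightarrow> nat \<Rightarrow> (nat \<Rightarrow> real) set" where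
  "lattice_alcove n m = int_vecs n \<inter> alcove_D n m"

definition alcove_nbrs :: "nat \<Rightarrow> nat \<Rightarrow> (nat \<Rightarrow> real) \<Rightarrow> (nat \<Rightarrow> real) set" where
  "alcove_nbrs n m x = {y \<in> alcove_D n m. y - x \<in> standard_steps n}"

definition alcove_fun :: "nat \<Rightarrow> nat \<Rightarrow> (nat \<Rightarrow> real) \<Rightarrow> real" where
  "alcove_fun n m x = (\<Prod>(h, t)\<in>{(h, t). 1 \<le> h \<and> h < t \<and> t \<le> n}.
     sin (pi * (x h - x t) / (2 * real m)) * sin (pi * (x h + x t) / (2 * real m)))"

text \<open>Matrix rows count from 0 and coordinates from 1, hence \<open>Suc i\<close>. A unit step
  in a coordinate becomes a shift of one angle by \<open>pi / m\<close>.\<close>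

definition angles :: "nat \<Rightarrow> (nat \<Rightarrow> real) \<Rightarrow> nat \<Rightarrow> real" where
  "angles m x i = x (Suc i) * pi / real m"

lemma finite_index_pairs: "finite {(h, t). 1 \<le> h \<and> h < t \<and> t \<le> (n::nat)}"
  by (rule finite_subset[of _ "{..n} \<times> {..n}"]) auto

lemma alcove_fun_cos_det:
  assumes "n \<ge> 1"
  shows "cos_det n (angles m x) = 2 ^ (n - 1)\<^sup>2 * alcove_fun n m x"
proof -
  let ?s = "\<lambda>i j. sin ((angles m x i - angles m x j) / 2) * sin ((angles m x i + angles m x j) / 2)"
  have half: "(angles m x i - angles m x j) / 2 = pi * (x (Suc i) - x (Suc j)) / (2 * real m)"
    "(angles m x i + angles m x j) / 2 = pi * (x (Suc i) + x (Suc j)) / (2 * real m)" for i j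
    by (simp_all add: angles_def diff_divide_distrib add_divide_distrib algebra_simps)
  have "(\<Prod>j<n. \<Prod>i<j. ?s i j) = (\<Prod>(j, i)\<in>(SIGMA j:{..<n}. {..<j}). ?s i j)"
    by (rule prod.Sigma) auto
  also have "\<dots> = alcove_fun n m x"
    unfolding alcove_fun_def
    by (rule prod.reindex_bij_witness[of _ "\<lambda>(h, t). (t - 1, h - 1)" "\<lambda>(j, i). (Suc i, Suc j)"])
      (auto simp: half)
  finally show ?thesis by (simp add: cos_det_product[OF assms])
qed

lemma Ints_less_imp_add1_le:
  fixes a b :: real
  assumes "a \<in> \<int>" "b \<in> \<int>" "a < b" shows "a + 1 \<le> b"
  using assms by (auto elim!: Ints_cases)

lemma standard_stepsE:
  assumes "s \<in> standard_steps n"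
  obtains j \<epsilon> where "j \<in> {1..n}" "\<epsilon> = 1 \<or> \<epsilon> = -1" "s = (\<lambda>i. if i = j then \<epsilon> else 0)"
proof -
  obtain j where j: "j \<in> {1..n}" "s = Defs.unit_vec j \<or> s = - Defs.unit_vec j"
    using assms unfolding standard_steps_def by blast
  then have "s = (\<lambda>i. if i = j then 1 else 0) \<or> s = (\<lambda>i. if i = j then -1 else 0)"
    by (auto simp: Defs.unit_vec_def fun_eq_iff)
  with j(1) that show thesis by blast
qed

lemma standard_steps_add_int_vecs:
  assumes "x \<in> int_vecs n" "y - x \<in> standard_steps n"
  shows "y \<in> int_vecs n"
proof -
  obtain j \<epsilon> where s: "j \<in> {1..n}" "\<epsilon> = 1 \<or> \<epsilon> = -1" "y - x = (\<lambda>i. if i = j then \<epsilon> else 0)"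
    using standard_stepsE[OF assms(2)] .
  have "y i = x i + (if i = j then \<epsilon> else 0)" for i
    using fun_cong[OF s(3), of i] by (simp add: algebra_simps)
  then show ?thesis using assms(1) s(1,2) by (auto simp: int_vecs_def real_vecs_def)
qed

context
  fixes n m :: nat
  assumes n3: "n \<ge> 3" and m1: "m \<ge> 1"
begin

lemma lattice_alcoveD:
  assumes "x \<in> lattice_alcove n m"
  shows "i \<notin> {1..n} \<Longrightarrow> x i = 0" "x i \<in> \<int>" "1 \<le> i \<Longrightarrow> i + 1 \<le> n - 1 \<Longrightarrow> x i > x (i + 1)"
    "x (n - 1) > \<bar>x n\<bar>" "x 1 + x 2 < 2 * real m"
proof -
  show z: "x i = 0" if "i \<notin> {1..n}" for i
    using assms that by (auto simp: lattice_alcove_def int_vecs_def real_vecs_def)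
  show "x i \<in> \<int>" using assms z[of i] by (cases "i \<in> {1..n}") (auto simp: lattice_alcove_def int_vecs_def)
qed (use assms in \<open>auto simp: lattice_alcove_def alcove_D_def\<close>)

lemma lattice_alcoveI:
  assumes "\<And>i. i \<notin> {1..n} \<Longrightarrow> x i = 0" "\<And>i. i \<in> {1..n} \<Longrightarrow> x i \<in> \<int>"
    "\<And>i. 1 \<le> i \<Longrightarrow> i + 1 \<le> n - 1 \<Longrightarrow> x i > x (i + 1)"
    "x (n - 1) > \<bar>x n\<bar>" "x 1 + x 2 < 2 * real m"
  shows "x \<in> lattice_alcove n m"
  using assms by (auto simp: lattice_alcove_def int_vecs_def real_vecs_def alcove_D_def)

text \<open>The absolute value treats \<open>x h - x t\<close> and \<open>x h + x t\<close>
  together, which are the arguments of the two sines in \<open>alcove_fun\<close>.\<close>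

lemma lattice_alcove_decreasing:
  assumes x: "x \<in> lattice_alcove n m" and "1 \<le> h" "h < t" "t \<le> n"
  shows "x h > \<bar>x t\<bar>"
proof -
  have chain: "x i > \<bar>x (Suc i)\<bar>" if "1 \<le> i" "Suc i \<le> n" for i
  proof -
    have "i \<le> n - 1" using that by simp
    then show ?thesis using that(1)
    proof (induction rule: inc_induct)
      case base
      then show ?case using lattice_alcoveD(4)[OF x] n3 by simp
    next
      case (step k)
      then have "x k > x (Suc k)" "x (Suc k) > \<bar>x (Suc (Suc k))\<bar>"
        using lattice_alcoveD(3)[OF x, of k] by auto
      then show ?case by auto
    qed
  qed
  have "Suc h \<le> t" using assms by simp
  then show ?thesis using assms(4)
  proof (induction t rule: dec_induct)
    case base
    then show ?case using chain assms by simp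
  next
    case (step k)
    then have "x h > \<bar>x k\<bar>" "x k > \<bar>x (Suc k)\<bar>" using chain[of k] assms(2) by auto
    then show ?case by linarith
  qed
qed

lemma lattice_alcove_bound:
  assumes x: "x \<in> lattice_alcove n m" and "1 \<le> h" "h < t" "t \<le> n"
  shows "x h + \<bar>x t\<bar> < 2 * real m"
proof -
  have "x h \<le> x 1" using lattice_alcove_decreasing[OF x, of 1 h] assms by (cases "h = 1") auto
  moreover have "\<bar>x t\<bar> \<le> x 2"
    using lattice_alcove_decreasing[OF x, of 2 t] lattice_alcove_decreasing[OF x, of 2 3] assms n3
    by (cases "t = 2") auto
  ultimately show ?thesis using lattice_alcoveD(5)[OF x] by simp
qed

text \<open>Strict inequalities between integers are gaps of at least 1, accumulated downwards from
  index \<open>n - 1\<close>. The bounds are attained by \<open>alcove_root\<close>.\<close>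

lemma lattice_alcove_ge:
  assumes x: "x \<in> lattice_alcove n m" and "1 \<le> i" "i < n"
  shows "x i \<ge> real (n - i)"
proof -
  have "i \<le> n - 1" using assms by simp
  then show ?thesis using assms(2)
  proof (induction rule: inc_induct)
    case base
    have "\<bar>x n\<bar> + 1 \<le> x (n - 1)"
      by (rule Ints_less_imp_add1_le) (use lattice_alcoveD[OF x] Ints_abs in blast)+
    moreover have "real (n - (n - 1)) = 1" using n3 by simp
    ultimately show ?case by linarith
  next
    case (step k)
    have "x (Suc k) + 1 \<le> x k"
      using Ints_less_imp_add1_le[of "x (Suc k)" "x k"] lattice_alcove_decreasing[OF x, of k "Suc k"]
        lattice_alcoveD(2)[OF x] step by fastforce
    then show ?case using step by (simp add: of_nat_diff)
  qed
qed

lemma finite_lattice_alcove: "finite (lattice_alcove n m)"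
proof -
  let ?B = "real_of_int ` {- 2 * int m..2 * int m}"
  have "finite {x :: nat \<Rightarrow> real. \<forall>i. (i \<in> {1..n} \<longrightarrow> x i \<in> ?B) \<and> (i \<notin> {1..n} \<longrightarrow> x i = 0)}"
    by (rule finite_set_of_finite_funs) auto
  moreover have "x i \<in> ?B" if x: "x \<in> lattice_alcove n m" and i: "i \<in> {1..n}" for x i
  proof -
    have "\<bar>x i\<bar> \<le> 2 * real m"
      using lattice_alcove_bound[OF x, of 1 i] lattice_alcove_bound[OF x, of 1 2]
        lattice_alcove_decreasing[OF x, of 1 i] lattice_alcove_decreasing[OF x, of 1 2] i n3 by (cases "i = 1") auto
    moreover obtain z where "x i = of_int z" using lattice_alcoveD(2)[OF x] by (auto elim: Ints_cases)
    ultimately show ?thesis by (intro image_eqI[of _ _ z]) auto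
  qed
  ultimately show ?thesis
    by (elim finite_subset[rotated]) (use lattice_alcoveD(1) in auto)
qed

lemma alcove_fun_pos:
  assumes x: "x \<in> lattice_alcove n m" shows "alcove_fun n m x > 0"
  unfolding alcove_fun_def
proof (rule prod_pos, clarify)
  fix h t assume ht: "1 \<le> h" "h < t" "t \<le> n"
  have "sin (pi * a / (2 * real m)) > 0" if "0 < a" "a < 2 * real m" for a
    using that m1 by (intro sin_gt_zero) (auto simp: field_simps)
  then show "0 < sin (pi * (x h - x t) / (2 * real m)) * sin (pi * (x h + x t) / (2 * real m))"
    using lattice_alcove_decreasing[OF x ht] lattice_alcove_bound[OF x ht]
    by (intro mult_pos_pos) auto
qed

text \<open>Each defining inequality holds at \<open>x\<close> with integral slack at least 1, and a
  unit step reduces that slack by at most 1. A violated inequality is therefore an equality at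
  \<open>y\<close>, which puts \<open>sin 0\<close> or \<open>sin pi\<close> among the
  factors.\<close>

lemma alcove_fun_wall:
  assumes x: "x \<in> lattice_alcove n m" and y: "y - x \<in> standard_steps n" "y \<notin> alcove_D n m"
  shows "alcove_fun n m y = 0"
proof -
  obtain j \<epsilon> where s: "j \<in> {1..n}" "\<epsilon> = 1 \<or> \<epsilon> = -1" "y - x = (\<lambda>i. if i = j then \<epsilon> else 0)"
    using standard_stepsE[OF y(1)] .
  have y_eq: "y i = x i + (if i = j then \<epsilon> else 0)" for i
    using fun_cong[OF s(3), of i] by (simp add: algebra_simps)
  have vanish: ?thesis if "1 \<le> h" "h < t" "t \<le> n" "y h = y t \<or> y h = - y t \<or> y h + y t = 2 * real m" for h t
  proof -
    have "pi * (y h + y t) / (2 * real m) = pi" if "y h + y t = 2 * real m"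
      using that m1 by simp
    then have "sin (pi * (y h - y t) / (2 * real m)) * sin (pi * (y h + y t) / (2 * real m)) = 0"
      using that by auto
    then show ?thesis
      unfolding alcove_fun_def using that(1-3) by (intro prod_zero finite_index_pairs) force
  qed
  have "y \<in> real_vecs n"
    using standard_steps_add_int_vecs[OF _ y(1)] x by (auto simp: lattice_alcove_def int_vecs_def)
  then consider i where "1 \<le> i" "i + 1 \<le> n - 1" "y i \<le> y (i + 1)"
    | "y (n - 1) \<le> \<bar>y n\<bar>" | "y 1 + y 2 \<ge> 2 * real m"
    using y(2) by (auto simp: alcove_D_def not_less)
  then show ?thesis
  proof cases
    case 1
    then have "x (i + 1) + 1 \<le> x i"
      using Ints_less_imp_add1_le lattice_alcoveD(2,3)[OF x] by blast
    then have "y i = y (i + 1)" using 1 s(2) unfolding y_eq by (auto split: if_splits)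
    then show ?thesis using 1 by (intro vanish[of i "i + 1"]) auto
  next
    case 2
    have "\<bar>x n\<bar> + 1 \<le> x (n - 1)"
      by (rule Ints_less_imp_add1_le) (use lattice_alcoveD[OF x] Ints_abs in blast)+
    then have "y (n - 1) = \<bar>y n\<bar>" using 2 s(2) unfolding y_eq by (auto split: if_splits)
    then show ?thesis using n3 by (intro vanish[of "n - 1" n]) auto
  next
    case 3
    have "x 1 + x 2 + 1 \<le> 2 * real m"
      by (rule Ints_less_imp_add1_le) (use lattice_alcoveD[OF x] in auto)
    then have "y 1 + y 2 = 2 * real m" using 3 s(2) unfolding y_eq by (auto split: if_splits)
    then show ?thesis using n3 by (intro vanish[of 1 2]) auto
  qed
qed

end

lemma sum_standard_steps:
  "(\<Sum>s\<in>standard_steps n. (f s :: real)) = (\<Sum>j=1..n. f (Defs.unit_vec j) + f (- Defs.unit_vec j))"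
proof -
  have ne: "Defs.unit_vec j \<noteq> - Defs.unit_vec k" for j k
    by (auto simp: Defs.unit_vec_def fun_eq_iff intro!: exI[of _ j])
  have inj: "Defs.unit_vec j = Defs.unit_vec k \<longleftrightarrow> j = k" for j k
    by (auto simp: Defs.unit_vec_def fun_eq_iff)
  have inj': "- Defs.unit_vec j = - Defs.unit_vec k \<longleftrightarrow> j = k" for j k
    by (auto simp: Defs.unit_vec_def fun_eq_iff)
  have "(\<Sum>s\<in>standard_steps n. f s) = (\<Sum>j=1..n. \<Sum>s\<in>{Defs.unit_vec j, - Defs.unit_vec j}. f s)"
    unfolding standard_steps_def
    by (rule sum.UNION_disjoint) (use ne ne[symmetric] in \<open>auto simp: inj inj'\<close>)
  then show ?thesis using ne by simp
qed

definition alcove_eigenvalue :: "nat \<Rightarrow> nat \<Rightarrow> real" where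
  "alcove_eigenvalue n m = 2 * (sin (real n * pi / (2 * real m)) * cos (real (n - 1) * pi / (2 * real m))
             / sin (pi / (2 * real m)))"

text \<open>A Dirichlet kernel: with \<open>a = pi / (2 m)\<close>,
  \<open>2 * sin a * cos (2 j a)\<close> is the difference of the sines of
  \<open>(2 j + 1) a\<close> and \<open>(2 j - 1) a\<close>. The sum telescopes, and the term
  \<open>j = 0\<close> leaves the extra \<open>sin a\<close>.\<close>

lemma alcove_eigenvalue_sum:
  assumes "n \<ge> 1" "m \<ge> 1"
  shows "(\<Sum>j<n. 2 * cos (real j * (pi / real m))) = alcove_eigenvalue n m"
proof -
  define a where "a = pi / (2 * real m)"
  have a: "sin a > 0" unfolding a_def using assms by (intro sin_gt_zero) (auto simp: field_simps)
  have am: "pi / real m = 2 * a" by (simp add: a_def)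
  obtain k where k: "n = Suc k" using assms by (cases n) auto
  have "sin a * (\<Sum>j<Suc k. 2 * cos (real j * (2 * a))) = sin (real (2 * k + 1) * a) + sin a"
  proof (induction k)
    case (Suc k)
    have "sin (real (2 * Suc k + 1) * a) - sin (real (2 * k + 1) * a) = 2 * sin a * cos (real (Suc k) * (2 * a))"
      by (subst sin_diff_sin) (simp add: algebra_simps add_divide_distrib)
    then show ?case using Suc by (simp add: algebra_simps)
  qed simp
  also have "\<dots> = 2 * sin (real (Suc k) * a) * cos (real k * a)"
    by (subst sin_plus_sin) (simp add: algebra_simps add_divide_distrib)
  finally show ?thesis
    unfolding am alcove_eigenvalue_def k using a by (simp add: a_def field_simps)
qed

context
  fixes n m :: nat
  assumes n3: "n \<ge> 3" and m1: "m \<ge> 1"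
begin

lemma alcove_fun_eigen:
  assumes x: "x \<in> lattice_alcove n m"
  shows "(\<Sum>y\<in>alcove_nbrs n m x. alcove_fun n m y) = alcove_eigenvalue n m * alcove_fun n m x"
proof -
  have fin: "finite (standard_steps n)" unfolding standard_steps_def by simp
  let ?shift = "\<lambda>s i. x i + s i"
  have inj: "inj_on ?shift (standard_steps n)" by (auto simp: inj_on_def fun_eq_iff)
  have img: "y \<in> ?shift ` standard_steps n \<longleftrightarrow> y - x \<in> standard_steps n" for y
  proof
    assume "y - x \<in> standard_steps n"
    moreover have "y = ?shift (y - x)" by auto
    ultimately show "y \<in> ?shift ` standard_steps n" by (rule image_eqI[where x = "y - x", rotated])
  next
    assume "y \<in> ?shift ` standard_steps n"
    then obtain s where "s \<in> standard_steps n" "y = ?shift s" by blast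
    moreover from this have "y - x = s" by auto
    ultimately show "y - x \<in> standard_steps n" by simp
  qed
  \<comment> \<open>Shifts that leave the alcove contribute 0 by \<open>alcove_fun_wall\<close>, so
    the sum may run over all \<open>2 n\<close> shifts and the identity for the free step operator
    applies.\<close>
  have "(\<Sum>y\<in>alcove_nbrs n m x. alcove_fun n m y) = (\<Sum>y\<in>?shift ` standard_steps n. alcove_fun n m y)"
    using fin alcove_fun_wall[OF n3 m1 x] img
    by (intro sum.mono_neutral_left) (auto simp: alcove_nbrs_def simp del: image_iff)
  also have "\<dots> = (\<Sum>j=1..n. alcove_fun n m (?shift (Defs.unit_vec j)) + alcove_fun n m (?shift (- Defs.unit_vec j)))"
    by (simp add: sum.reindex[OF inj] sum_standard_steps)
  also have "\<dots> = (\<Sum>j<n. alcove_fun n m (?shift (Defs.unit_vec (Suc j))) + alcove_fun n m (?shift (- Defs.unit_vec (Suc j))))"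
    by (rule sum.reindex_bij_witness[of _ Suc "\<lambda>j. j - 1"]) auto
  finally have 1: "(\<Sum>y\<in>alcove_nbrs n m x. alcove_fun n m y) =
    (\<Sum>j<n. alcove_fun n m (?shift (Defs.unit_vec (Suc j))) + alcove_fun n m (?shift (- Defs.unit_vec (Suc j))))" .
  have ang: "angles m (?shift (Defs.unit_vec (Suc j))) = (angles m x)(j := angles m x j + pi / real m)"
    "angles m (?shift (- Defs.unit_vec (Suc j))) = (angles m x)(j := angles m x j - pi / real m)" for j
    by (auto simp: angles_def Defs.unit_vec_def fun_eq_iff algebra_simps add_divide_distrib diff_divide_distrib)
  have n1: "n \<ge> 1" using n3 by simp
  have "2 ^ (n - 1)\<^sup>2 * (\<Sum>y\<in>alcove_nbrs n m x. alcove_fun n m y) =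
      2 ^ (n - 1)\<^sup>2 * (alcove_eigenvalue n m * alcove_fun n m x)"
    using cos_det_eigen[of n "angles m x" "pi / real m"]
    unfolding 1 ang[symmetric] alcove_fun_cos_det[OF n1] alcove_eigenvalue_sum[OF n1 m1]
    by (simp only: sum_distrib_left distrib_left mult_ac)
  then show ?thesis by simp
qed

end

section \<open>Counting walks in the alcove\<close>

lemma walks_Suc:
  assumes "x \<in> R"
  shows "walks n (Suc k) x y R = (\<Union>z\<in>{z \<in> R. z - x \<in> standard_steps n}. (#) x ` walks n k z y R)"
    (is "?L = ?R")
proof -
  have walks_alt: "p \<in> walks n k x y R \<longleftrightarrow> length p = Suc k \<and> p ! 0 = x \<and> p ! k = y \<and>
      (\<forall>i<k. p ! Suc i - p ! i \<in> standard_steps n) \<and> (\<forall>i<Suc k. p ! i \<in> R)" for p k x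
  proof -
    have "(\<forall>i\<in>{1..k}. p ! i - p ! (i - 1) \<in> standard_steps n) \<longleftrightarrow>
        (\<forall>i<k. p ! Suc i - p ! i \<in> standard_steps n)"
      by (metis One_nat_def Suc_le_eq Suc_pred atLeastAtMost_iff diff_Suc_1 le_add1 plus_1_eq_Suc)
    then show ?thesis unfolding walks_def less_Suc_eq_le by simp
  qed
  show ?thesis
  proof (intro equalityI subsetI)
    fix p assume p: "p \<in> ?L"
    then obtain q where q: "p = x # q" "length q = Suc k" unfolding walks_alt
      by (cases p) auto
    have "q \<in> walks n k (q ! 0) y R" "q ! 0 \<in> R" "q ! 0 - x \<in> standard_steps n"
      using p unfolding walks_alt q All_less_Suc2 by auto
    then show "p \<in> ?R" using q by blast
  next
    fix p assume "p \<in> ?R"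
    then show "p \<in> ?L" using assms unfolding walks_alt by (auto simp: All_less_Suc2 walks_alt)
  qed
qed

lemma num_walks_eq_walk_count:
  assumes "x \<in> R"
  shows "real (num_walks n k x y R) = walk_count (\<lambda>x. {z \<in> R. z - x \<in> standard_steps n}) k x y"
  using assms
proof (induction k arbitrary: x)
  case 0
  have "walks n 0 x y R = (if x = y then {[x]} else {})"
    using 0 by (auto simp: walks_def length_Suc_conv)
  then show ?case by (simp add: num_walks_def)
next
  case (Suc k)
  let ?E = "{z \<in> R. z - x \<in> standard_steps n}"
  have "finite (standard_steps n)" unfolding standard_steps_def by simp
  then have fin: "finite ?E"
  proof (rule inj_on_finite[rotated 2])
    show "inj_on (\<lambda>z. z - x) ?E" by (auto simp: inj_on_def fun_eq_iff)
  qed auto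
  have "num_walks n (Suc k) x y R = (\<Sum>z\<in>?E. card ((#) x ` walks n k z y R))"
    unfolding num_walks_def walks_Suc[OF Suc.prems]
  proof (rule card_UN_disjoint[OF fin])
    show "\<forall>i\<in>?E. \<forall>j\<in>?E. i \<noteq> j \<longrightarrow> (#) x ` walks n k i y R \<inter> (#) x ` walks n k j y R = {}"
      by (auto simp: walks_def)
  qed (simp add: finite_walks)
  also have "\<dots> = (\<Sum>z\<in>?E. num_walks n k z y R)"
    by (simp add: card_image num_walks_def)
  finally have "real (num_walks n (Suc k) x y R) = (\<Sum>z\<in>?E. real (num_walks n k z y R))"
    by (simp only: of_nat_sum)
  also have "\<dots> = (\<Sum>z\<in>?E. walk_count (\<lambda>x. {z \<in> R. z - x \<in> standard_steps n}) k z y)"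
    by (intro sum.cong refl Suc.IH) blast
  finally show ?case by (simp only: walk_count.simps)
qed

lemma coord_sum_step:
  assumes "y - x \<in> standard_steps n"
  shows "coord_sum n y = coord_sum n x + 1 \<or> coord_sum n y = coord_sum n x - 1"
proof -
  obtain j \<epsilon> where s: "j \<in> {1..n}" "\<epsilon> = 1 \<or> \<epsilon> = -1" "y - x = (\<lambda>i. if i = j then \<epsilon> else 0)"
    using standard_stepsE[OF assms] .
  have "y i = x i + (if i = j then \<epsilon> else 0)" for i
    using fun_cong[OF s(3), of i] by (simp add: algebra_simps)
  then have "coord_sum n y = coord_sum n x + \<epsilon>"
    using s(1) by (simp add: coord_sum_def sum.distrib)
  then show ?thesis using s(2) by auto
qed

lemma coord_sum_Ints: "x \<in> int_vecs n \<Longrightarrow> coord_sum n x \<in> \<int>"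
  unfolding coord_sum_def int_vecs_def by auto

text \<open>On lattice points the coordinate sum is an integer of type \<open>real\<close>; the
  floor moves it to \<open>int\<close>, where parity is available.\<close>

definition alcove_colour :: "nat \<Rightarrow> (nat \<Rightarrow> real) \<Rightarrow> bool" where
  "alcove_colour n x = even \<lfloor>coord_sum n x\<rfloor>"

lemma alcove_colour_step:
  assumes "x \<in> int_vecs n" "y - x \<in> standard_steps n"
  shows "alcove_colour n y \<noteq> alcove_colour n x"
proof -
  obtain c where "coord_sum n x = of_int c" using coord_sum_Ints[OF assms(1)] by (auto elim: Ints_cases)
  then have "\<lfloor>coord_sum n y\<rfloor> = c + 1 \<or> \<lfloor>coord_sum n y\<rfloor> = c - 1" "\<lfloor>coord_sum n x\<rfloor> = c"
    using coord_sum_step[OF assms(2)] by auto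
  then show ?thesis unfolding alcove_colour_def by auto
qed

text \<open>Translates the congruence in the filter of the main statement into the colour condition
  of \<open>walk_count_asymptotics\<close>.\<close>

lemma rcong_2_iff_colours:
  assumes "x \<in> int_vecs n" "y \<in> int_vecs n"
  shows "[real k = coord_sum n x + coord_sum n y] (rmod 2) \<longleftrightarrow>
    even k = (alcove_colour n x = alcove_colour n y)"
proof -
  obtain a b where ab: "coord_sum n x = of_int a" "coord_sum n y = of_int b"
    using assms[THEN coord_sum_Ints] by (auto elim!: Ints_cases)
  have "[real k = of_int (a + b)] (rmod 2) \<longleftrightarrow> even (a + b - int k)"
  proof
    assume "[real k = of_int (a + b)] (rmod 2)"
    then obtain z where "of_int (a + b) = real k + of_int z * 2" by (auto simp: rcong_altdef)
    then have "of_int (a + b - int k) = (of_int (2 * z) :: real)" by simp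
    then have "a + b - int k = 2 * z" by (simp only: of_int_eq_iff)
    then show "even (a + b - int k)" by simp
  next
    assume "even (a + b - int k)"
    then obtain z where "a + b - int k = 2 * z" by (elim evenE)
    then have "of_int (a + b - int k) = (of_int (2 * z) :: real)" by simp
    then have "of_int (a + b) = real k + of_int z * 2" by simp
    then show "[real k = of_int (a + b)] (rmod 2)" unfolding rcong_altdef by blast
  qed
  then show ?thesis by (auto simp: ab alcove_colour_def)
qed

section \<open>Connectedness of the alcove\<close>

text \<open>The vector \<open>(n - 1, ..., 1, 0)\<close>, the Weyl vector of type D. By
  \<open>lattice_alcove_ge\<close> it lies as close as possible to the lower walls, so it belongs to
  every nonempty lattice alcove.\<close>

definition alcove_root :: "nat \<Rightarrow> nat \<Rightarrow> real" where
  "alcove_root n i = (if i \<in> {1..n} then real (n - i) else 0)"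

context
  fixes n m :: nat
  assumes n3: "n \<ge> 3" and m1: "m \<ge> 1"
begin

lemma alcove_nbrs_lattice_alcove:
  assumes "x \<in> lattice_alcove n m" shows "alcove_nbrs n m x \<subseteq> lattice_alcove n m"
  using assms standard_steps_add_int_vecs[of x n]
  by (auto simp: alcove_nbrs_def lattice_alcove_def)

lemma alcove_nbrs_sym:
  assumes "x \<in> lattice_alcove n m" "y \<in> alcove_nbrs n m x" shows "x \<in> alcove_nbrs n m y"
proof -
  have "x - y = - (y - x)" by auto
  moreover have "- s \<in> standard_steps n" if s: "s \<in> standard_steps n" for s
  proof -
    have "- (- Defs.unit_vec j) = Defs.unit_vec j" for j by auto
    then show ?thesis using s unfolding standard_steps_def by auto
  qed
  ultimately show ?thesis using assms by (auto simp: alcove_nbrs_def lattice_alcove_def)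
qed

lemma alcove_root_in_lattice_alcove:
  assumes "x \<in> lattice_alcove n m" shows "alcove_root n \<in> lattice_alcove n m"
proof (rule lattice_alcoveI[OF n3 m1])
  have "x 1 \<ge> real (n - 1)" "x 2 \<ge> real (n - 2)"
    using lattice_alcove_ge[OF n3 m1 assms, of 1] lattice_alcove_ge[OF n3 m1 assms, of 2] n3 by auto
  moreover have "alcove_root n 1 = real (n - 1)" "alcove_root n 2 = real (n - 2)"
    using n3 by (auto simp: alcove_root_def)
  ultimately show "alcove_root n 1 + alcove_root n 2 < 2 * real m"
    using lattice_alcoveD(5)[OF n3 m1 assms] by linarith
qed (use n3 in \<open>auto simp: alcove_root_def\<close>)

text \<open>The coordinate to move is the last one that differs from the root. All later coordinates
  have their root values, so integrality leaves room for one step towards 0.\<close>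

lemma alcove_descent:
  assumes x: "x \<in> lattice_alcove n m" "x \<noteq> alcove_root n"
  obtains y where "y \<in> alcove_nbrs n m x" "(\<Sum>i=1..n. \<bar>y i\<bar>) = (\<Sum>i=1..n. \<bar>x i\<bar>) - 1"
proof -
  note D = lattice_alcoveD[OF n3 m1 x(1)]
  define I where "I = {i \<in> {1..n}. x i \<noteq> real (n - i)}"
  have "I \<noteq> {}" using x D(1) unfolding I_def alcove_root_def by fastforce
  define j where "j = Max I"
  have j: "j \<in> I" "\<And>i. i \<in> I \<Longrightarrow> i \<le> j"
    using Max_in[OF _ \<open>I \<noteq> {}\<close>] Max_ge[of I] unfolding j_def by (auto simp: I_def)
  have jn: "1 \<le> j" "j \<le> n" "x j \<noteq> real (n - j)" using j(1) by (auto simp: I_def)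
  have above: "x i = real (n - i)" if "j < i" "i \<le> n" for i
    using j(2)[of i] that jn by (auto simp: I_def)
  \<comment> \<open>The direction matters at \<open>j = n\<close>, where the coordinate may be
    negative; for \<open>j < n\<close> the coordinate exceeds \<open>n - j\<close> and \<epsilon> is
    1.\<close>
  define \<epsilon> :: real where "\<epsilon> = (if x j > 0 then 1 else -1)"
  have xj: "\<bar>x j - \<epsilon>\<bar> = \<bar>x j\<bar> - 1"
  proof -
    have "x j \<noteq> 0" using jn D(3)[of j] D(4) lattice_alcove_ge[OF n3 m1 x(1), of j] by (cases "j = n") auto
    moreover obtain z where "x j = of_int z" using D(2)[of j] by (auto elim: Ints_cases)
    ultimately show ?thesis by (auto simp: \<epsilon>_def abs_if)
  qed
  have large: "x j \<ge> real (n - j) + 1" "\<epsilon> = 1" if "j < n"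
  proof -
    have "x j > real (n - j)" using lattice_alcove_ge[OF n3 m1 x(1), of j] jn that by simp
    then show "x j \<ge> real (n - j) + 1" using Ints_less_imp_add1_le[of "real (n - j)" "x j"] D(2) by simp
    then show "\<epsilon> = 1" by (simp add: \<epsilon>_def)
  qed
  define y where "y i = (if i = j then x i - \<epsilon> else x i)" for i
  have "y - x \<in> standard_steps n"
  proof -
    have "y - x = (if x j > 0 then - Defs.unit_vec j else Defs.unit_vec j)"
      by (auto simp: y_def Defs.unit_vec_def \<epsilon>_def fun_eq_iff)
    then show ?thesis using jn unfolding standard_steps_def by auto
  qed
  moreover have "y \<in> lattice_alcove n m"
  proof (rule lattice_alcoveI[OF n3 m1])
    show "y i = 0" if "i \<notin> {1..n}" for i using that D(1) jn by (auto simp: y_def)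
    show "y i \<in> \<int>" for i using D(2) by (auto simp: y_def \<epsilon>_def)
    show "y i > y (i + 1)" if "1 \<le> i" "i + 1 \<le> n - 1" for i
    proof (cases "i = j")
      case True
      then have "x (i + 1) = real (n - i) - 1" using above[of "i + 1"] that by (simp add: of_nat_diff)
      moreover have "j < n" using that True by linarith
      ultimately show ?thesis using large True by (simp add: y_def)
    next
      case False
      then show ?thesis using D(3)[OF that] large that by (auto simp: y_def)
    qed
    show "\<bar>y n\<bar> < y (n - 1)"
    proof (cases "j = n")
      case True
      then show ?thesis using D(4) xj n3 by (auto simp: y_def)
    next
      case False
      then have "x n = 0" using above[of n] jn by simp
      moreover have "x (n - 1) - 1 > 0" if "j = n - 1"
        using large that n3 by simp
      ultimately show ?thesis using D(4) False large jn by (auto simp: y_def)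
    qed
    show "y 1 + y 2 < 2 * real m" using D(5) large n3 jn by (cases "j < n") (auto simp: y_def)
  qed
  moreover have "(\<Sum>i=1..n. \<bar>y i\<bar>) = (\<Sum>i=1..n. \<bar>x i\<bar>) - 1"
  proof -
    have "(\<Sum>i=1..n. \<bar>y i\<bar>) = (\<Sum>i=1..n. \<bar>x i\<bar> - (if i = j then 1 else 0))"
      using xj by (intro sum.cong) (auto simp: y_def)
    then show ?thesis using jn by (simp add: sum_subtractf)
  qed
  ultimately show thesis by (intro that[of y]) (auto simp: alcove_nbrs_def lattice_alcove_def)
qed

lemma walk_to_alcove_root:
  assumes "x \<in> lattice_alcove n m"
  shows "\<exists>k. walk_count (alcove_nbrs n m) k x (alcove_root n) > 0"
  using assms
proof (induction "nat \<lfloor>\<Sum>i=1..n. \<bar>x i\<bar>\<rfloor>" arbitrary: x rule: less_induct)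
  case less
  show ?case
  proof (cases "x = alcove_root n")
    case True
    then have "walk_count (alcove_nbrs n m) 0 x (alcove_root n) > 0" by simp
    then show ?thesis by blast
  next
    case False
    obtain y where y: "y \<in> alcove_nbrs n m x" "(\<Sum>i=1..n. \<bar>y i\<bar>) = (\<Sum>i=1..n. \<bar>x i\<bar>) - 1"
      using alcove_descent[OF less.prems False] .
    have "(\<Sum>i=1..n. \<bar>y i\<bar>) \<ge> 0" by (intro sum_nonneg) auto
    then have "nat \<lfloor>\<Sum>i=1..n. \<bar>y i\<bar>\<rfloor> < nat \<lfloor>\<Sum>i=1..n. \<bar>x i\<bar>\<rfloor>"
      unfolding y(2) by (simp add: zless_nat_eq_int_zless)
    moreover have "y \<in> lattice_alcove n m" using y alcove_nbrs_lattice_alcove less.prems by blast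
    ultimately obtain k where k: "walk_count (alcove_nbrs n m) k y (alcove_root n) > 0"
      using less.hyps by blast
    have "finite (alcove_nbrs n m x)"
      using alcove_nbrs_lattice_alcove[OF less.prems] finite_lattice_alcove[OF n3 m1] finite_subset by blast
    then have "walk_count (alcove_nbrs n m) (Suc k) x (alcove_root n) > 0"
      using k y(1) by (auto intro!: sum_pos2[of _ y] walk_count_nonneg)
    then show ?thesis by blast
  qed
qed

end

section \<open>Folding sums along reflections\<close>

text \<open>Here \<open>r\<close> is a reflection and \<open>t\<close> a signed distance to its
  mirror. The negative side is matched with the positive one, so points off the mirror acquire
  multiplicity 2.\<close>

lemma sum_fold_involution:
  fixes t :: "'a \<Rightarrow> real" and F :: "'a \<Rightarrow> real"
  assumes fin: "finite A" and r: "\<And>x. x \<in> A \<Longrightarrow> r x \<in> A" "\<And>x. x \<in> A \<Longrightarrow> r (r x) = x"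
    and t: "\<And>x. x \<in> A \<Longrightarrow> t (r x) = - t x" and F: "\<And>x. x \<in> A \<Longrightarrow> F (r x) = F x"
  shows "(\<Sum>x\<in>A. F x) = (\<Sum>x | x \<in> A \<and> t x \<ge> 0. (if t x = 0 then 1 else 2) * F x)"
proof -
  let ?N = "{x \<in> A. t x < 0}" and ?P = "{x \<in> A. t x > 0}" and ?Z = "{x \<in> A. t x = 0}"
  have "(\<Sum>x\<in>?N. F x) = (\<Sum>x\<in>?P. F x)"
    by (rule sum.reindex_bij_witness[of _ r r]) (use r t F in auto)
  moreover have "(\<Sum>x\<in>A. F x) = (\<Sum>x\<in>?N. F x) + ((\<Sum>x\<in>?P. F x) + (\<Sum>x\<in>?Z. F x))"
    by (subst sum.union_disjoint[symmetric], use fin in auto)+ (intro sum.cong, auto)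
  moreover have "(\<Sum>x | x \<in> A \<and> t x \<ge> 0. (if t x = 0 then 1 else 2) * F x) =
    (\<Sum>x\<in>?P \<union> ?Z. (if t x = 0 then 1 else 2) * F x)" by (intro sum.cong) auto
  moreover have "\<dots> = (\<Sum>x\<in>?P. 2 * F x) + (\<Sum>x\<in>?Z. F x)"
    by (subst sum.union_disjoint) (use fin in \<open>auto intro!: arg_cong2[where f = "(+)"] sum.cong\<close>)
  ultimately show ?thesis by (simp add: sum_distrib_left[symmetric])
qed

lemma cos_det_cong_cos:
  assumes "\<And>i j. i < n \<Longrightarrow> cos (real j * \<theta> i) = cos (real j * \<theta>' i)"
  shows "cos_det n \<theta> = cos_det n \<theta>'"
  unfolding cos_det_leibniz using assms by simp

section \<open>The norm of the eigenfunction\<close>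

text \<open>A fundamental domain for the two reflections. Its points are the strictly decreasing
  sequences in \<open>{0..m}\<close>, that is, \<open>n\<close>-element subsets of that set.\<close>

definition half_alcove :: "nat \<Rightarrow> nat \<Rightarrow> (nat \<Rightarrow> real) set" where
  "half_alcove n m = {x \<in> lattice_alcove n m. x 1 \<le> real m \<and> 0 \<le> x n}"

definition nat_coord :: "(nat \<Rightarrow> real) \<Rightarrow> nat \<Rightarrow> nat" where
  "nat_coord x i = nat \<lfloor>x i\<rfloor>"

definition coord_set :: "nat \<Rightarrow> (nat \<Rightarrow> real) \<Rightarrow> nat set" where
  "coord_set n x = nat_coord x ` {1..n}"

context
  fixes n m :: nat
  assumes n3: "n \<ge> 3" and m1: "m \<ge> 1"
begin

lemma half_alcove_coord:
  assumes x: "x \<in> half_alcove n m" and i: "i \<in> {1..n}"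
  shows "real (nat_coord x i) = x i"
proof -
  have xa: "x \<in> lattice_alcove n m" using x by (simp add: half_alcove_def)
  have "x i \<ge> 0"
    using lattice_alcove_decreasing[OF n3 m1 xa, of i n] x i by (cases "i = n") (auto simp: half_alcove_def)
  then show ?thesis using lattice_alcoveD(2)[OF n3 m1 xa, of i] by (auto simp: nat_coord_def elim: Ints_cases)
qed

lemma half_alcove_coord_less:
  assumes x: "x \<in> half_alcove n m" and ij: "1 \<le> i" "i < j" "j \<le> n"
  shows "nat_coord x j < nat_coord x i"
proof -
  have "x j < x i"
    using lattice_alcove_decreasing[OF n3 m1 _ ij, of x] x by (auto simp: half_alcove_def)
  moreover have "real (nat_coord x i) = x i" "real (nat_coord x j) = x j"
    using ij by (intro half_alcove_coord[OF x]; simp)+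
  ultimately have "real (nat_coord x j) < real (nat_coord x i)" by (simp only:)
  then show ?thesis by (simp only: of_nat_less_iff)
qed

lemma half_alcove_coord_inj:
  assumes x: "x \<in> half_alcove n m" shows "inj_on (nat_coord x) {1..n}"
proof (rule linorder_inj_onI)
  fix i j :: nat assume "i < j" "i \<in> {1..n}" "j \<in> {1..n}"
  then have "nat_coord x j < nat_coord x i" by (intro half_alcove_coord_less[OF x]) auto
  then show "nat_coord x i \<noteq> nat_coord x j" by (metis less_irrefl)
qed auto

lemma bij_betw_coord_set:
  "bij_betw (coord_set n) (half_alcove n m) {Y. Y \<subseteq> {..m} \<and> card Y = n}"
proof (rule bij_betw_byWitness)
  \<comment> \<open>Sorted lists increase while coordinates decrease: index \<open>n - i\<close>
    sends coordinate 1 to the largest element and coordinate \<open>n\<close> to the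
    smallest.\<close>
  let ?g = "\<lambda>Y i. if i \<in> {1..n} then real (sorted_list_of_set Y ! (n - i)) else 0"
  show "\<forall>x\<in>half_alcove n m. ?g (coord_set n x) = x"
  proof
    fix x assume x: "x \<in> half_alcove n m"
    define l where "l = map (\<lambda>k. nat_coord x (n - k)) [0..<n]"
    have "sorted_wrt (<) l"
      unfolding l_def sorted_wrt_iff_nth_less by (auto intro!: half_alcove_coord_less[OF x])
    moreover have "set l = coord_set n x"
    proof -
      have "(\<lambda>k. n - k) ` {0..<n} = {1..n}"
      proof (intro equalityI subsetI)
        fix i assume "i \<in> {1..n}"
        then show "i \<in> (\<lambda>k. n - k) ` {0..<n}" by (intro image_eqI[of _ _ "n - i"]) auto
      qed auto
      then have "nat_coord x ` (\<lambda>k. n - k) ` {0..<n} = coord_set n x" by (simp only: coord_set_def)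
      then show ?thesis by (simp add: l_def image_image)
    qed
    moreover have "length l = card (coord_set n x)"
      using card_image[OF half_alcove_coord_inj[OF x]] by (simp add: l_def coord_set_def)
    ultimately have l: "sorted_list_of_set (coord_set n x) = l"
      using sorted_list_of_set_unique[of "coord_set n x" l] by (simp add: coord_set_def)
    show "?g (coord_set n x) = x"
    proof
      fix i
      have "l ! (n - i) = nat_coord x i" if "i \<in> {1..n}" using that by (simp add: l_def)
      then show "?g (coord_set n x) i = x i"
        unfolding l using half_alcove_coord[OF x, of i] lattice_alcoveD(1)[OF n3 m1, of x i] x
        by (auto simp: half_alcove_def)
    qed
  qed
  have g: "?g Y \<in> half_alcove n m \<and> coord_set n (?g Y) = Y" if Y: "Y \<subseteq> {..m}" "card Y = n" for Y
  proof -
    have fin: "finite Y" using Y finite_subset by blast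
    define l where "l = sorted_list_of_set Y"
    have l: "length l = n" "set l = Y" "sorted_wrt (<) l"
      using fin Y by (auto simp: l_def strict_sorted_list_of_set)
    have less: "l ! i < l ! j" if "i < j" "j < n" for i j
      using sorted_wrt_nth_less[OF l(3)] that l(1) by simp
    have le: "l ! i \<le> m" if "i < n" for i using nth_mem[of i l] that l Y by auto
    have "?g Y \<in> lattice_alcove n m"
    proof (rule lattice_alcoveI[OF n3 m1])
      show "?g Y i > ?g Y (i + 1)" if "1 \<le> i" "i + 1 \<le> n - 1" for i
      proof -
        have "l ! (n - (i + 1)) < l ! (n - i)" using that by (intro less) linarith+
        moreover have "i \<in> {1..n}" "i + 1 \<in> {1..n}" using that by auto
        ultimately show ?thesis by (simp only: l_def if_True of_nat_less_iff)
      qed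
      show "\<bar>?g Y n\<bar> < ?g Y (n - 1)"
        using less[of 0 1] n3 by (simp add: l_def)
      \<comment> \<open>The two largest elements are distinct and at most \<open>m\<close>, so their
        sum is strictly below \<open>2 m\<close>.\<close>
      show "?g Y 1 + ?g Y 2 < 2 * real m"
      proof -
        have "l ! (n - 2) < l ! (n - 1)" "l ! (n - 1) \<le> m" using n3 by (intro less le; linarith)+
        then have "real (l ! (n - 1)) + real (l ! (n - 2)) < 2 * real m" by linarith
        moreover have "1 \<in> {1..n}" "2 \<in> {1..n}" using n3 by auto
        ultimately show ?thesis by (simp only: l_def if_True)
      qed
    qed auto
    moreover have "?g Y 1 \<le> real m" using le[of "n - 1"] n3 by (simp add: l_def)
    moreover have "coord_set n (?g Y) = Y"
    proof -
      have "coord_set n (?g Y) = (\<lambda>i. l ! (n - i)) ` {1..n}"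
        unfolding coord_set_def by (intro image_cong) (auto simp: l_def nat_coord_def)
      also have "\<dots> = (!) l ` {0..<n}"
      proof (intro equalityI subsetI)
        fix y assume "y \<in> (!) l ` {0..<n}"
        then obtain i where "i < n" "y = l ! i" by auto
        then show "y \<in> (\<lambda>i. l ! (n - i)) ` {1..n}" by (intro image_eqI[of _ _ "n - i"]) auto
      qed auto
      also have "\<dots> = Y" using l(1,2) set_conv_nth[of l] by auto
      finally show ?thesis .
    qed
    ultimately show ?thesis by (auto simp: half_alcove_def)
  qed
  then show "\<forall>Y\<in>{Y. Y \<subseteq> {..m} \<and> card Y = n}. coord_set n (?g Y) = Y"
    "?g ` {Y. Y \<subseteq> {..m} \<and> card Y = n} \<subseteq> half_alcove n m" by auto
  show "coord_set n ` half_alcove n m \<subseteq> {Y. Y \<subseteq> {..m} \<and> card Y = n}"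
  proof clarify
    fix x assume x: "x \<in> half_alcove n m"
    have "card (coord_set n x) = n"
      using card_image[OF half_alcove_coord_inj[OF x]] by (simp add: coord_set_def)
    moreover have "nat_coord x i \<le> m" if "i \<in> {1..n}" for i
    proof -
      have "x i \<le> x 1"
        using lattice_alcove_decreasing[OF n3 m1 _, of x 1 i] x that by (cases "i = 1") (auto simp: half_alcove_def)
      also have "\<dots> \<le> real m" using x by (simp add: half_alcove_def)
      finally have "real (nat_coord x i) \<le> real m" unfolding half_alcove_coord[OF x that] .
      then show ?thesis by (simp only: of_nat_le_iff)
    qed
    ultimately show "coord_set n x \<subseteq> {..m} \<and> card (coord_set n x) = n"
      by (auto simp: coord_set_def)
  qed
qed

text \<open>In a strictly decreasing sequence only the first coordinate can be \<open>m\<close> and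
  only the last can be 0. On its mirror such a coordinate has multiplicity 1 and weight 1/2, off it
  multiplicity 2 and weight 1: a factor 2 at each of the two ends.\<close>

lemma prod_end_weight_coord_set:
  assumes x: "x \<in> half_alcove n m"
  shows "4 * (\<Prod>y\<in>coord_set n x. end_weight m y) =
    (if x n = 0 then 1 else 2) * (if real m - x 1 = 0 then 1 else 2)"
proof -
  define k where "k = nat_coord x"
  have less: "k j < k i" if "1 \<le> i" "i < j" "j \<le> n" for i j
    using half_alcove_coord_less[OF x that] by (simp add: k_def)
  have k_eq: "real (k i) = x i" if "i \<in> {1..n}" for i
    using half_alcove_coord[OF x that] by (simp add: k_def)
  have "x 1 \<le> real m" using x by (simp add: half_alcove_def)
  then have "real (k 1) \<le> real m" using n3 by (subst k_eq) auto
  then have k1: "k 1 \<le> m" by (simp only: of_nat_le_iff)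
  have one: "end_weight m (k i) = 1" if "i \<in> {2..n - 1}" for i
  proof -
    have "k i < k 1" "k n < k i" using that n3 by (intro less; simp; linarith)+
    then show ?thesis using k1 by (simp add: end_weight_def)
  qed
  have "(\<Prod>y\<in>coord_set n x. end_weight m y) = (\<Prod>i\<in>{1..n}. end_weight m (k i))"
    unfolding coord_set_def k_def by (simp only: prod.reindex[OF half_alcove_coord_inj[OF x]] o_def)
  also have "{1..n} = insert 1 (insert n {2..n - 1})" using n3 by auto
  also have "(\<Prod>i\<in>\<dots>. end_weight m (k i)) = end_weight m (k 1) * (end_weight m (k n) * (\<Prod>i\<in>{2..n - 1}. end_weight m (k i)))"
    using n3 by simp
  also have "(\<Prod>i\<in>{2..n - 1}. end_weight m (k i)) = 1" using one by (intro prod.neutral) blast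
  finally have eq: "(\<Prod>y\<in>coord_set n x. end_weight m y) = end_weight m (k 1) * end_weight m (k n)" by simp
  have "end_weight m (k 1) = (if real m - x 1 = 0 then 1 / 2 else 1)"
    using less[of 1 n] k_eq[of 1] n3 by (auto simp: end_weight_def)
  moreover have "end_weight m (k n) = (if x n = 0 then 1 / 2 else 1)"
    using less[of 1 n] k_eq[of n] k1 n3 by (auto simp: end_weight_def)
  ultimately show ?thesis unfolding eq by simp
qed

lemma cos_det_half_alcove:
  assumes x: "x \<in> half_alcove n m"
  shows "(cos_det n (angles m x))\<^sup>2 = set_det_sq m (coord_set n x)"
proof -
  let ?y = "\<lambda>i. nat_coord x (Suc i)"
  have "angles m x i = real (?y i) * pi / real m" if "i < n" for i
    using half_alcove_coord[OF x, of "Suc i"] that by (simp add: angles_def)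
  then have "cos_det n (angles m x) = cos_det n (\<lambda>i. real (?y i) * pi / real m)"
    by (intro cos_det_cong_cos) simp
  moreover have Suc_img: "Suc ` {0..<n} = {1..n}" by (simp add: atLeastLessThanSuc_atLeastAtMost)
  have "inj_on (nat_coord x \<circ> Suc) {0..<n}"
    by (rule comp_inj_on) (simp_all only: Suc_img half_alcove_coord_inj[OF x] inj_Suc)
  moreover have "?y ` {0..<n} = coord_set n x"
    unfolding coord_set_def Suc_img[symmetric] image_image ..
  ultimately show ?thesis using cos_det_squared[of n ?y m] n3 by (simp add: o_def)
qed

text \<open>Folding along \<open>x 1 = m\<close> and \<open>x n = 0\<close> reduces the sum over the alcove to one over
  \<open>n\<close>-element subsets of \<open>{0..m}\<close>.\<close>

lemma sum_cos_det_sq: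
  assumes "n \<le> m"
  shows "(\<Sum>x\<in>lattice_alcove n m. (cos_det n (angles m x))\<^sup>2) = 4 * (real m ^ n / 2 ^ (n - 1))"
proof -
  let ?V = "lattice_alcove n m"
  let ?F = "\<lambda>x. (cos_det n (angles m x))\<^sup>2"
  let ?r = "\<lambda>x :: nat \<Rightarrow> real. x(1 := 2 * real m - x 1)" and ?q = "\<lambda>x :: nat \<Rightarrow> real. x(n := - x n)"
  let ?w = "\<lambda>x :: nat \<Rightarrow> real. if real m - x 1 = 0 then 1 else (2 :: real)"
  have Fr: "?F (?r x) = ?F x" for x
  proof -
    have "cos (real j * angles m (?r x) i) = cos (real j * angles m x i)" for i j
    proof (cases i)
      case 0
      \<comment> \<open>The reflection replaces the first angle by \<open>2 pi\<close> minus it, and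
        an integral multiple keeps its cosine.\<close>
      have "real j * angles m (?r x) 0 = 2 * real j * pi - real j * angles m x 0"
        using m1 by (simp add: angles_def field_simps)
      then show ?thesis unfolding 0 by (simp only: cos_diff cos_2npi sin_2npi)
    qed (simp add: angles_def)
    then show ?thesis by (subst cos_det_cong_cos[of n _ "angles m x"]) auto
  qed
  have Fq: "?F (?q x) = ?F x" for x
  proof -
    have "cos (real j * angles m (?q x) i) = cos (real j * angles m x i)" for i j
      by (auto simp: angles_def)
    then show ?thesis by (subst cos_det_cong_cos[of n _ "angles m x"]) auto
  qed
  \<comment> \<open>The reflection exchanges the inequalities \<open>x 1 > x 2\<close> and
    \<open>x 1 + x 2 < 2 m\<close>. As \<open>n \<ge> 3\<close>, coordinate 1 does not enter the
    inequality between coordinates \<open>n - 1\<close> and \<open>n\<close>.\<close>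
  have r: "?r x \<in> ?V" if x: "x \<in> ?V" for x
  proof (rule lattice_alcoveI[OF n3 m1])
    note D = lattice_alcoveD[OF n3 m1 x]
    show "?r x i = 0" if "i \<notin> {1..n}" for i using that D(1) n3 by auto
    show "?r x i \<in> \<int>" for i using D(2) by auto
    show "?r x i > ?r x (i + 1)" if "1 \<le> i" "i + 1 \<le> n - 1" for i
      using that D(3)[OF that] D(5) by (cases "i = 1") (auto simp: numeral_2_eq_2)
    show "\<bar>?r x n\<bar> < ?r x (n - 1)" using D(4) n3 by auto
    show "?r x 1 + ?r x 2 < 2 * real m" using D(3)[of 1] n3 by (auto simp: numeral_2_eq_2)
  qed
  have q: "?q x \<in> ?V" if x: "x \<in> ?V" for x
  proof (rule lattice_alcoveI[OF n3 m1])
    note D = lattice_alcoveD[OF n3 m1 x]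
    show "?q x i = 0" if "i \<notin> {1..n}" for i using that D(1) n3 by auto
    show "?q x i \<in> \<int>" for i using D(2) by auto
    show "?q x i > ?q x (i + 1)" if "1 \<le> i" "i + 1 \<le> n - 1" for i
      using that D(3)[OF that] by auto
    show "\<bar>?q x n\<bar> < ?q x (n - 1)" using D(4) n3 by auto
    show "?q x 1 + ?q x 2 < 2 * real m" using D(5) n3 by auto
  qed
  have "(\<Sum>x\<in>?V. ?F x) = (\<Sum>x | x \<in> ?V \<and> real m - x 1 \<ge> 0. ?w x * ?F x)"
    by (rule sum_fold_involution[of _ ?r]) (use Fr r finite_lattice_alcove[OF n3 m1] in auto)
  also have "\<dots> = (\<Sum>x | x \<in> {x. x \<in> ?V \<and> real m - x 1 \<ge> 0} \<and> x n \<ge> 0.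
      (if x n = 0 then 1 else 2) * (?w x * ?F x))"
    by (rule sum_fold_involution[of _ ?q])
      (use Fq q finite_lattice_alcove[OF n3 m1] n3 in auto)
  also have "{x. x \<in> {x. x \<in> ?V \<and> real m - x 1 \<ge> 0} \<and> x n \<ge> 0} = half_alcove n m"
    by (auto simp: half_alcove_def)
  also have "(\<Sum>x\<in>half_alcove n m. (if x n = 0 then 1 else 2) * (?w x * ?F x)) =
    (\<Sum>x\<in>half_alcove n m. 4 * ((\<Prod>y\<in>coord_set n x. end_weight m y) * set_det_sq m (coord_set n x)))"
  proof (intro sum.cong refl)
    fix x assume x: "x \<in> half_alcove n m"
    show "(if x n = 0 then 1 else 2) * (?w x * ?F x) =
        4 * ((\<Prod>y\<in>coord_set n x. end_weight m y) * set_det_sq m (coord_set n x))"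
      unfolding cos_det_half_alcove[OF x, symmetric] mult.assoc[symmetric] prod_end_weight_coord_set[OF x] ..
  qed
  also have "\<dots> = (\<Sum>Y | Y \<subseteq> {..m} \<and> card Y = n. 4 * ((\<Prod>y\<in>Y. end_weight m y) * set_det_sq m Y))"
    by (rule sum.reindex_bij_betw[OF bij_betw_coord_set])
  also have "\<dots> = 4 * (real m ^ n / 2 ^ (n - 1))"
    unfolding sum_distrib_left[symmetric] using sum_set_det_sq[of n m] n3 assms by simp
  finally show ?thesis .
qed

lemma alcove_fun_norm:
  assumes "n \<le> m"
  shows "2 / (\<Sum>x\<in>lattice_alcove n m. (alcove_fun n m x)\<^sup>2) = 4 ^ (n\<^sup>2) / (8 * real m) ^ n"
proof -
  obtain k where k: "n = Suc k" using n3 by (cases n) auto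
  have four: "((2::real) ^ j)\<^sup>2 = 4 ^ j" for j
    by (simp add: power2_eq_square flip: power_mult_distrib)
  have "4 ^ k\<^sup>2 * (\<Sum>x\<in>lattice_alcove n m. (alcove_fun n m x)\<^sup>2) =
      (\<Sum>x\<in>lattice_alcove n m. (cos_det n (angles m x))\<^sup>2)"
    using n3 by (simp add: alcove_fun_cos_det power_mult_distrib four sum_distrib_left k)
  also have "\<dots> = 4 * (real m ^ n / 2 ^ k)" using sum_cos_det_sq[OF assms] k by simp
  finally have N: "(\<Sum>x\<in>lattice_alcove n m. (alcove_fun n m x)\<^sup>2) = 4 * (real m ^ n / 2 ^ k) / 4 ^ k\<^sup>2"
    by (simp add: field_simps)
  \<comment> \<open>With \<open>n = k + 1\<close> the exponent is
    \<open>k\<^sup>2 + 2 k + 1\<close>; splitting \<open>16 ^ k\<close> as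
    \<open>2 ^ k * 8 ^ k\<close> matches the \<open>2 ^ k\<close> of the norm and the
    \<open>8 ^ n\<close> of the claimed prefactor.\<close>
  have pow: "(4::real) ^ n\<^sup>2 = 4 * 4 ^ k\<^sup>2 * 2 ^ k * 8 ^ k"
  proof -
    have "(4::real) ^ n\<^sup>2 = 4 * 4 ^ k\<^sup>2 * (4 ^ k * 4 ^ k)"
      unfolding k by (simp add: power2_eq_square power_add)
    also have "(4::real) ^ k * 4 ^ k = 2 ^ k * 8 ^ k" by (simp flip: power_mult_distrib)
    finally show ?thesis by simp
  qed
  show ?thesis unfolding N pow power_mult_distrib using m1 k by (simp add: field_simps)
qed

end

lemma alcove_eigenvalue_pos:
  assumes "n \<ge> 1" "n \<le> m" shows "alcove_eigenvalue n m > 0"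
proof -
  have "sin (real n * pi / (2 * real m)) > 0" "sin (pi / (2 * real m)) > 0"
    using assms by (auto intro!: sin_gt_zero simp: field_simps)
  moreover have "cos (real (n - 1) * pi / (2 * real m)) > 0"
  \<comment> \<open>This is where \<open>n \<le> m\<close> enters: the angle stays below
    \<open>pi / 2\<close> because \<open>n - 1 < m\<close>.\<close>
  proof (rule cos_gt_zero_pi)
    have "real (n - 1) / real m < 1" using assms by simp
    then have "real (n - 1) / real m * (pi / 2) < 1 * (pi / 2)" by (rule mult_strict_right_mono) simp
    then show "real (n - 1) * pi / (2 * real m) < pi / 2" by (simp only: times_divide_times_eq mult.commute mult_1)
    have "- (pi / 2) < 0" by simp
    also have "0 \<le> real (n - 1) * pi / (2 * real m)" by simp
    finally show "- (pi / 2) < real (n - 1) * pi / (2 * real m)" .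
  qed
  ultimately show ?thesis unfolding alcove_eigenvalue_def by simp
qed

theorem theorem29:
  fixes n m :: nat and \<eta> lam :: "nat \<Rightarrow> real"
  assumes "n \<ge> 3" and "m \<ge> 1"
    and "\<eta> \<in> int_vecs n \<inter> alcove_D n m"
    and "lam \<in> int_vecs n \<inter> alcove_D n m"
  shows "(\<lambda>k::nat. real (num_walks n k \<eta> lam (alcove_D n m)))
     \<sim>[inf at_top (principal {k::nat. [real k = coord_sum n \<eta> + coord_sum n lam] (rmod 2)})]
     (\<lambda>k. 4 ^ (n\<^sup>2) / (8 * real m) ^ n *
       (2 * (sin (real n * pi / (2 * real m)) * cos (real (n - 1) * pi / (2 * real m))
             / sin (pi / (2 * real m)))) ^ k *
       (\<Prod>(h, t)\<in>{(h, t). 1 \<le> h \<and> h < t \<and> t \<le> n}.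
          sin (pi * (\<eta> h - \<eta> t) / (2 * real m)) * sin (pi * (lam h - lam t) / (2 * real m)) *
          sin (pi * (\<eta> h + \<eta> t) / (2 * real m)) * sin (pi * (lam h + lam t) / (2 * real m))))"
proof -
  note nm = assms(1,2)
  let ?V = "lattice_alcove n m" and ?E = "alcove_nbrs n m" and ?\<phi> = "alcove_fun n m"
    and ?\<mu> = "alcove_eigenvalue n m"
  let ?F = "inf at_top (principal {k::nat. [real k = coord_sum n \<eta> + coord_sum n lam] (rmod 2)})"
  have \<eta>: "\<eta> \<in> ?V" and lam: "lam \<in> ?V" using assms by (auto simp: lattice_alcove_def)
  have count: "real (num_walks n k \<eta> lam (alcove_D n m)) = walk_count ?E k \<eta> lam" for k
    unfolding alcove_nbrs_def by (rule num_walks_eq_walk_count) (use assms(3) in blast)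
  have prod: "(\<Prod>(h, t)\<in>{(h, t). 1 \<le> h \<and> h < t \<and> t \<le> n}.
      sin (pi * (\<eta> h - \<eta> t) / (2 * real m)) * sin (pi * (lam h - lam t) / (2 * real m)) *
      sin (pi * (\<eta> h + \<eta> t) / (2 * real m)) * sin (pi * (lam h + lam t) / (2 * real m))) = ?\<phi> \<eta> * ?\<phi> lam"
    unfolding alcove_fun_def prod.distrib[symmetric]
    by (intro prod.cong refl) (auto simp: mult_ac)
  have "(\<lambda>k. walk_count ?E k \<eta> lam) \<sim>[?F] (\<lambda>k. 4 ^ (n\<^sup>2) / (8 * real m) ^ n * ?\<mu> ^ k * (?\<phi> \<eta> * ?\<phi> lam))"
  proof (cases "n \<le> m")
    case True
    have \<mu>: "?\<mu> > 0" using alcove_eigenvalue_pos[of n m] True nm by simp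
    interpret bipartite_eigenfunction ?V ?E "alcove_colour n" ?\<phi> ?\<mu> "alcove_root n"
    proof
      show "alcove_colour n y \<noteq> alcove_colour n x" if "x \<in> ?V" "y \<in> ?E x" for x y
        using that by (intro alcove_colour_step) (auto simp: lattice_alcove_def alcove_nbrs_def)
      show "finite ?V" by (rule finite_lattice_alcove[OF nm])
      show "?E x \<subseteq> ?V" if "x \<in> ?V" for x by (rule alcove_nbrs_lattice_alcove[OF nm that])
      show "x \<in> ?E y" if "x \<in> ?V" "y \<in> ?E x" for x y by (rule alcove_nbrs_sym[OF nm that])
      show "?\<phi> x > 0" if "x \<in> ?V" for x by (rule alcove_fun_pos[OF nm that])
      show "?\<mu> > 0" by (rule \<mu>)
      show "(\<Sum>y\<in>?E x. ?\<phi> y) = ?\<mu> * ?\<phi> x" if "x \<in> ?V" for x by (rule alcove_fun_eigen[OF nm that])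
      show "alcove_root n \<in> ?V" by (rule alcove_root_in_lattice_alcove[OF nm \<eta>])
      show "\<exists>k. walk_count ?E k x (alcove_root n) > 0" if "x \<in> ?V" for x
        by (rule walk_to_alcove_root[OF nm that])
    qed
    define c where "c = 4 ^ (n\<^sup>2) / (8 * real m) ^ n * (?\<phi> \<eta> * ?\<phi> lam)"
    have c: "c \<noteq> 0" unfolding c_def using \<phi>_pos[OF \<eta>] \<phi>_pos[OF lam] nm by simp
    have "((\<lambda>k. walk_count ?E k \<eta> lam / ?\<mu> ^ k) \<longlongrightarrow> 2 * ?\<phi> \<eta> * ?\<phi> lam / (\<Sum>x\<in>?V. (?\<phi> x)\<^sup>2)) ?F"
      using walk_count_asymptotics[OF \<eta> lam] assms(3,4) by (simp add: rcong_2_iff_colours)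
    also have "2 * ?\<phi> \<eta> * ?\<phi> lam / (\<Sum>x\<in>?V. (?\<phi> x)\<^sup>2) = c"
      unfolding c_def alcove_fun_norm[OF nm True, symmetric] by simp
    finally have "((\<lambda>k. walk_count ?E k \<eta> lam / ?\<mu> ^ k / c) \<longlongrightarrow> c / c) ?F"
      using c by (intro tendsto_divide tendsto_const)
    then show ?thesis
      unfolding divide_self[OF c] by (intro asymp_equivI') (simp add: c_def mult_ac)
  next
    case False
    \<comment> \<open>The minimal values of the first two coordinates give
      \<open>2 n - 3 < 2 m\<close>; together with \<open>m < n\<close> this leaves only
      \<open>n = m + 1\<close>.\<close>
    have "\<eta> 1 \<ge> real (n - 1)" "\<eta> 2 \<ge> real (n - 2)"
      using nm by (intro lattice_alcove_ge[OF nm \<eta>]; simp)+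
    then have "real (n - 1 + (n - 2)) < real (2 * m)"
      using lattice_alcoveD(5)[OF nm \<eta>] by simp
    then have "n - 1 + (n - 2) < 2 * m" by (simp only: of_nat_less_iff)
    then have "n - 1 = m" using False nm by linarith
    then have "real (n - 1) * pi / (2 * real m) = pi / 2" using nm by simp
    then have \<mu>: "?\<mu> = 0" unfolding alcove_eigenvalue_def by (simp only: cos_pi_half)
    \<comment> \<open>At eigenvalue 0 the positive values of \<phi> at the neighbours would have to
      sum to 0.\<close>
    have "?E \<eta> = {}"
    proof (rule ccontr)
      assume "?E \<eta> \<noteq> {}"
      then have "(\<Sum>y\<in>?E \<eta>. ?\<phi> y) > 0"
        using alcove_nbrs_lattice_alcove[OF nm \<eta>] finite_subset[OF _ finite_lattice_alcove[OF nm]]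
        by (intro sum_pos alcove_fun_pos[OF nm]) auto
      then show False using alcove_fun_eigen[OF nm \<eta>] \<mu> by simp
    qed
    then have "walk_count ?E k \<eta> lam = 0" if "k > 0" for k
      using that by (cases k) auto
    \<comment> \<open>Both sides are 0 for \<open>k > 0\<close>, and \<open>asymp_equiv\<close>
      reads the ratio 0/0 as 1. At \<open>k = 0\<close> the right-hand side is not 0, since
      \<open>0 ^ 0 = 1\<close>, so the equality is claimed only eventually.\<close>
    then have "\<forall>\<^sub>F k in at_top. walk_count ?E k \<eta> lam =
        4 ^ (n\<^sup>2) / (8 * real m) ^ n * ?\<mu> ^ k * (?\<phi> \<eta> * ?\<phi> lam)"
      using \<mu> by (intro eventually_mono[OF eventually_gt_at_top[of 0]]) auto
    then show ?thesis
      by (intro asymp_equiv_refl_ev filter_leD[OF inf_le1])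
  qed
  then show ?thesis unfolding count prod alcove_eigenvalue_def .
qed

end
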